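(* Let $W$ be a finitely generated infinite Coxeter group which is irreducible and $2$-spherical, i.e. $W$ admits a Coxeter generating set $S$ which is irreducible and $2$-spherical. Then $W$ is bipolar.
   Context: Let $S$ be a Coxeter generating set of a finitely generated Coxeter group $W$. $S$ is $2$-spherical if every two-element subset of $S$ generates a finite group. For $K\subset S$, $K^\perp$ is the set of elements of $S\setminus K$ commuting with all elements of $K$; $S$ is irreducible if it is not of the form $K\cup K^\perp$ for any non-empty proper subset $K\subset S$. Bipolarity. Let $X$ be the Cayley graph of $W$ with respect to a finite generating set, with the path-metric in which edges have length $1$, and identify $W$ with the vertex set of $X$. For $H\subset X$ let $\mathcal N^X_k(H)=\{x\in X: d(x,H)\le k\}$. For a subset $H\subset W$, a pole of $(W,H)$ is a chain $U_1\supset U_2\supset\cdots$ where $U_k$ is a non-empty connected component of $X\setminus\mathcal N^X_k(H)$. The number of poles $\tilde e(W,H)$ does not depend on the chosen finite generating set. An element $s$ of a Coxeter generating set is bipolar if $\tilde e(W,\mathscr Z_W(s))=2$, where $\mathscr Z_W(s)$ is the centraliser of $s$ in $W$. $W$ is bipolar if it admits a Coxeter generating set all of whose elements are bipolar. *)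

theory Defs
  imports "HOL-Analysis.Analysis" "HOL-Algebra.Generated_Groups" "HOL-Library.Extended_Nat"
begin

section \<open>Group presentations and Coxeter generating sets\<close>

text \<open>
  Words in the alphabet \<open>S \<union> S\<inverse>\<close>: the letter \<open>(s, True)\<close> stands for \<open>s\<close> and \<open>(s, False)\<close>
  for the formal inverse of \<open>s\<close>.
\<close>

type_synonym 'a gword = "('a \<times> bool) list"

definition gwords :: "'a set \<Rightarrow> 'a gword set" where
  "gwords S = lists (S \<times> UNIV)"

primrec gword_eval :: "('a, 'b) monoid_scheme \<Rightarrow> 'a gword \<Rightarrow> 'a" where
  "gword_eval G [] = \<one>\<^bsub>G\<^esub>"
| "gword_eval G (x # w) = (if snd x then fst x else inv\<^bsub>G\<^esub> (fst x)) \<otimes>\<^bsub>G\<^esub> gword_eval G w"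

text \<open>
  Equality of words in the abstract group with generators \<open>S\<close> and relators \<open>R\<close>, i.e. in the
  quotient of the free group on \<open>S\<close> by the normal closure of \<open>R\<close>.
\<close>

inductive pres_eq :: "'a set \<Rightarrow> 'a gword set \<Rightarrow> 'a gword \<Rightarrow> 'a gword \<Rightarrow> bool"
  for S :: "'a set" and R :: "'a gword set" where
  refl: "w \<in> gwords S \<Longrightarrow> pres_eq S R w w"
| sym: "pres_eq S R v w \<Longrightarrow> pres_eq S R w v"
| trans: "pres_eq S R u v \<Longrightarrow> pres_eq S R v w \<Longrightarrow> pres_eq S R u w"
| cancel: "u \<in> gwords S \<Longrightarrow> v \<in> gwords S \<Longrightarrow> s \<in> S \<Longrightarrow>
    pres_eq S R (u @ [(s, b), (s, \<not> b)] @ v) (u @ v)"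
| relator: "u \<in> gwords S \<Longrightarrow> v \<in> gwords S \<Longrightarrow> r \<in> R \<Longrightarrow> r \<in> gwords S \<Longrightarrow>
    pres_eq S R (u @ r @ v) (u @ v)"

text \<open>
  \<open>G\<close> is presented by \<open>\<langle>S | R\<rangle>\<close>, where the abstract generators are the elements of
  \<open>S \<subseteq> G\<close> themselves: the canonical map from the abstractly presented group to \<open>G\<close> is onto
  (first two conjuncts), well-defined and injective (last conjunct).
\<close>

definition presented_by :: "('a, 'b) monoid_scheme \<Rightarrow> 'a set \<Rightarrow> 'a gword set \<Rightarrow> bool" where
  "presented_by G S R \<longleftrightarrow>
     S \<subseteq> carrier G \<and> generate G S = carrier G \<and>
     (\<forall>v\<in>gwords S. \<forall>w\<in>gwords S. gword_eval G v = gword_eval G w \<longleftrightarrow> pres_eq S R v w)"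

definition coxeter_matrix_on :: "'a set \<Rightarrow> ('a \<Rightarrow> 'a \<Rightarrow> enat) \<Rightarrow> bool" where
  "coxeter_matrix_on S m \<longleftrightarrow>
     (\<forall>s\<in>S. m s s = 1) \<and> (\<forall>s\<in>S. \<forall>t\<in>S. s \<noteq> t \<longrightarrow> m s t = m t s \<and> 2 \<le> m s t)"

definition coxeter_relators :: "'a set \<Rightarrow> ('a \<Rightarrow> 'a \<Rightarrow> enat) \<Rightarrow> 'a gword set" where
  "coxeter_relators S m =
     {concat (replicate n [(s, True), (t, True)]) | s t n. s \<in> S \<and> t \<in> S \<and> m s t = enat n}"

definition coxeter_generating_set :: "('a, 'b) monoid_scheme \<Rightarrow> 'a set \<Rightarrow> bool" where
  "coxeter_generating_set W S \<longleftrightarrow>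
     (\<exists>m. coxeter_matrix_on S m \<and> presented_by W S (coxeter_relators S m))"

definition finite_generating_set :: "('a, 'b) monoid_scheme \<Rightarrow> 'a set \<Rightarrow> bool" where
  "finite_generating_set G A \<longleftrightarrow> finite A \<and> A \<subseteq> carrier G \<and> generate G A = carrier G"

definition finitely_generated :: "('a, 'b) monoid_scheme \<Rightarrow> bool" where
  "finitely_generated G \<longleftrightarrow> (\<exists>A. finite_generating_set G A)"

definition two_spherical :: "('a, 'b) monoid_scheme \<Rightarrow> 'a set \<Rightarrow> bool" where
  "two_spherical W S \<longleftrightarrow> (\<forall>T. T \<subseteq> S \<and> card T = 2 \<longrightarrow> finite (generate W T))"

definition cox_perp :: "('a, 'b) monoid_scheme \<Rightarrow> 'a set \<Rightarrow> 'a set \<Rightarrow> 'a set" where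
  "cox_perp W S K = {s \<in> S - K. \<forall>k\<in>K. s \<otimes>\<^bsub>W\<^esub> k = k \<otimes>\<^bsub>W\<^esub> s}"

definition irreducible_gens :: "('a, 'b) monoid_scheme \<Rightarrow> 'a set \<Rightarrow> bool" where
  "irreducible_gens W S \<longleftrightarrow> \<not> (\<exists>K. K \<noteq> {} \<and> K \<subset> S \<and> S = K \<union> cox_perp W S K)"

definition centraliser :: "('a, 'b) monoid_scheme \<Rightarrow> 'a \<Rightarrow> 'a set" where
  "centraliser W s = {w \<in> carrier W. w \<otimes>\<^bsub>W\<^esub> s = s \<otimes>\<^bsub>W\<^esub> w}"


section \<open>The Cayley graph as a metric space\<close>

text \<open>
  The Cayley graph is realised geometrically by barycentric coordinates: a point is a function
  \<open>p\<close> on vertices, the point at distance \<open>t\<close> from \<open>g\<close> on the edge \<open>{g, g a}\<close> having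
  coordinates \<open>1 - t\<close> at \<open>g\<close> and \<open>t\<close> at \<open>g a\<close>.  A group element corresponds to its indicator
  function.  The graph is the simple undirected one: parallel edges (from \<open>a\<close> and \<open>a\<inverse>\<close>) are
  identified, and a loop (from \<open>a = \<one>\<close>) degenerates to its vertex.
\<close>

definition cayley_cells :: "('a, 'b) monoid_scheme \<Rightarrow> 'a set \<Rightarrow> 'a set set" where
  "cayley_cells G A = {{g} | g. g \<in> carrier G} \<union> {{g, g \<otimes>\<^bsub>G\<^esub> a} | g a. g \<in> carrier G \<and> a \<in> A}"

definition closed_cell :: "'a set \<Rightarrow> ('a \<Rightarrow> real) set" where
  "closed_cell e = {p. (\<forall>v. 0 \<le> p v) \<and> (\<forall>v. v \<notin> e \<longrightarrow> p v = 0) \<and> (\<Sum>v\<in>e. p v) = 1}"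

definition cayley_graph :: "('a, 'b) monoid_scheme \<Rightarrow> 'a set \<Rightarrow> ('a \<Rightarrow> real) set" where
  "cayley_graph G A = (\<Union>e\<in>cayley_cells G A. closed_cell e)"

definition cayley_vertex :: "'a \<Rightarrow> 'a \<Rightarrow> real" where
  "cayley_vertex g = (\<lambda>v. if v = g then 1 else 0)"

text \<open>
  The path-metric is the infimum of the lengths of polygonal paths, i.e. of finite strings of
  points any two consecutive ones of which lie in a common closed cell.  On an edge \<open>{u, v}\<close>
  we have \<open>\<bar>p u - q u\<bar> = \<bar>p v - q v\<bar>\<close>, which is the length of the segment from \<open>p\<close> to \<open>q\<close>;
  hence the factor \<open>1/2\<close> below, which gives each edge length 1.
\<close>

definition segment_length :: "('a \<Rightarrow> real) \<Rightarrow> ('a \<Rightarrow> real) \<Rightarrow> real" where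
  "segment_length p q = (\<Sum>v | p v \<noteq> q v. \<bar>p v - q v\<bar>) / 2"

fun path_length :: "('a \<Rightarrow> real) list \<Rightarrow> real" where
  "path_length (p # q # ps) = segment_length p q + path_length (q # ps)"
| "path_length _ = 0"

definition polygonal_paths ::
    "('a, 'b) monoid_scheme \<Rightarrow> 'a set \<Rightarrow> ('a \<Rightarrow> real) \<Rightarrow> ('a \<Rightarrow> real) \<Rightarrow> ('a \<Rightarrow> real) list set" where
  "polygonal_paths G A p q =
     {ps. ps \<noteq> [] \<and> hd ps = p \<and> last ps = q \<and>
          successively (\<lambda>x y. \<exists>e\<in>cayley_cells G A. x \<in> closed_cell e \<and> y \<in> closed_cell e) ps}"

text \<open>
  The value off the Cayley graph is a dummy, chosen so that the axioms of
  \<^locale>\<open>Metric_space\<close> that are not relativised to the carrier hold.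
\<close>

definition cayley_dist ::
    "('a, 'b) monoid_scheme \<Rightarrow> 'a set \<Rightarrow> ('a \<Rightarrow> real) \<Rightarrow> ('a \<Rightarrow> real) \<Rightarrow> real" where
  "cayley_dist G A p q =
     (if p \<in> cayley_graph G A \<and> q \<in> cayley_graph G A
      then (INF ps\<in>polygonal_paths G A p q. path_length ps) else 0)"

lemma segment_length_nonneg: "0 \<le> segment_length p q"
  unfolding segment_length_def by (simp add: sum_nonneg)

lemma segment_length_commute: "segment_length p q = segment_length q p"
  unfolding segment_length_def by (simp add: abs_minus_commute eq_commute)

lemma path_length_nonneg: "0 \<le> path_length ps"
  by (induction ps rule: path_length.induct) (auto simp: segment_length_nonneg)

lemma path_length_append:
  "ps \<noteq> [] \<Longrightarrow> path_length (ps @ qs) = path_length ps + path_length (last ps # qs)"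
  by (induction ps rule: path_length.induct) auto

lemma path_length_rev: "path_length (rev ps) = path_length ps"
proof (induction ps rule: path_length.induct)
  case (1 p q ps)
  have "path_length (rev (p # q # ps)) = path_length (rev (q # ps) @ [p])" by simp
  also have "\<dots> = path_length (rev (q # ps)) + segment_length q p"
    by (subst path_length_append) auto
  finally show ?case using 1 by (simp add: segment_length_commute)
qed auto

lemma polygonal_paths_rev:
  "ps \<in> polygonal_paths G A p q \<Longrightarrow> rev ps \<in> polygonal_paths G A q p"
  by (auto simp: polygonal_paths_def hd_rev last_rev conj_commute)

lemma polygonal_paths_append:
  assumes "ps \<in> polygonal_paths G A p q" "qs \<in> polygonal_paths G A q r"
  shows "ps @ tl qs \<in> polygonal_paths G A p r"
    and "path_length (ps @ tl qs) = path_length ps + path_length qs"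
proof -
  have qs: "qs = q # tl qs" and "ps \<noteq> []" "last ps = q"
    using assms by (auto simp: polygonal_paths_def)
  show "path_length (ps @ tl qs) = path_length ps + path_length qs"
    using path_length_append[OF \<open>ps \<noteq> []\<close>, of "tl qs"] qs \<open>last ps = q\<close> by simp
  show "ps @ tl qs \<in> polygonal_paths G A p r"
    using assms qs unfolding polygonal_paths_def
    by (cases "tl qs"; cases qs) (auto simp: successively_append_iff)
qed

lemma cayley_cell_card: "e \<in> cayley_cells G A \<Longrightarrow> \<exists>u v. e = {u, v}"
  unfolding cayley_cells_def by blast

lemma coord_le_segment_length:
  assumes "e \<in> cayley_cells G A" "p \<in> closed_cell e" "q \<in> closed_cell e"
  shows "\<bar>p v - q v\<bar> \<le> segment_length p q"
proof -
  obtain a b where e: "e = {a, b}" using cayley_cell_card[OF assms(1)] by blast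
  have off: "x \<notin> e \<Longrightarrow> p x = 0 \<and> q x = 0" for x using assms by (auto simp: closed_cell_def)
  have "(\<Sum>x | p x \<noteq> q x. \<bar>p x - q x\<bar>) = (\<Sum>x\<in>e. \<bar>p x - q x\<bar>)"
    by (rule sum.mono_neutral_left) (use e off in auto)
  moreover have "sum p e = 1" "sum q e = 1" using assms by (auto simp: closed_cell_def)
  ultimately show ?thesis
    using off[of v] by (cases "a = b"; cases "v = a"; cases "v = b") (auto simp: segment_length_def e)
qed

lemma coord_le_path_length:
  assumes "ps \<in> polygonal_paths G A p q" shows "\<bar>p v - q v\<bar> \<le> path_length ps"
  using assms
proof (induction ps arbitrary: p rule: path_length.induct)
  case (1 x y ps)
  then have "y # ps \<in> polygonal_paths G A y q" and x: "x = p" by (auto simp: polygonal_paths_def)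
  then have "\<bar>y v - q v\<bar> \<le> path_length (y # ps)" using 1 by blast
  moreover have "\<bar>x v - y v\<bar> \<le> segment_length x y"
    using 1(2) coord_le_segment_length by (fastforce simp: polygonal_paths_def)
  ultimately show ?case using x by simp
qed (auto simp: polygonal_paths_def)

lemma cayley_vertex_in_cell: "finite e \<Longrightarrow> g \<in> e \<Longrightarrow> cayley_vertex g \<in> closed_cell e"
  by (auto simp: cayley_vertex_def closed_cell_def)

lemma polygonal_paths_cell:
  "e \<in> cayley_cells G A \<Longrightarrow> p \<in> closed_cell e \<Longrightarrow> q \<in> closed_cell e \<Longrightarrow> [p, q] \<in> polygonal_paths G A p q"
  by (auto simp: polygonal_paths_def)

lemma polygonal_paths_edge:
  assumes "g \<in> carrier G" "a \<in> A"
  shows "[cayley_vertex g, cayley_vertex (g \<otimes>\<^bsub>G\<^esub> a)] \<in> 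
    polygonal_paths G A (cayley_vertex g) (cayley_vertex (g \<otimes>\<^bsub>G\<^esub> a))"
  by (rule polygonal_paths_cell[where e = "{g, g \<otimes>\<^bsub>G\<^esub> a}"])
     (use assms in \<open>auto simp: cayley_cells_def intro!: cayley_vertex_in_cell\<close>)

lemma polygonal_paths_vertices:
  fixes G (structure)
  assumes "group G" "A \<subseteq> carrier G" "h \<in> generate G A" "g \<in> carrier G"
  shows "polygonal_paths G A (cayley_vertex g) (cayley_vertex (g \<otimes>\<^bsub>G\<^esub> h)) \<noteq> {}"
proof -
  interpret group G by fact
  show ?thesis using assms(3,4)
  proof (induction arbitrary: g rule: generate.induct)
    case one
    have "[cayley_vertex g] \<in> polygonal_paths G A (cayley_vertex g) (cayley_vertex g)"
      by (simp add: polygonal_paths_def)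
    then show ?case using one by auto
  next
    case (incl h)
    then show ?case using polygonal_paths_edge by fast
  next
    case (inv h)
    then have h: "h \<in> carrier G" using assms(2) by auto
    have "g \<otimes> inv h \<in> carrier G" "g \<otimes> inv h \<otimes> h = g" using h inv by (auto simp: m_assoc)
    then show ?case using polygonal_paths_rev polygonal_paths_edge[of "g \<otimes> inv h" G h A] inv
      by (metis equals0D)
  next
    case (eng h1 h2)
    then have h: "h1 \<in> carrier G" "h2 \<in> carrier G"
      using generate_in_carrier assms(2) by blast+
    then have "g \<otimes> (h1 \<otimes> h2) = g \<otimes> h1 \<otimes> h2" using eng by (simp add: m_assoc)
    then show ?case using eng h polygonal_paths_append(1)
      by (metis equals0I ex_in_conv m_closed)
  qed
qed

lemma polygonal_paths_nonempty:
  fixes G (structure)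
  assumes "group G" "A \<subseteq> carrier G" "generate G A = carrier G"
    "p \<in> cayley_graph G A" "q \<in> cayley_graph G A"
  shows "polygonal_paths G A p q \<noteq> {}"
proof -
  interpret group G by fact
  have *: "\<exists>g\<in>carrier G. polygonal_paths G A p (cayley_vertex g) \<noteq> {}" if p: "p \<in> cayley_graph G A" for p
  proof -
    from p obtain e where e: "e \<in> cayley_cells G A" "p \<in> closed_cell e" by (auto simp: cayley_graph_def)
    then obtain g where g: "g \<in> e" "g \<in> carrier G" by (auto simp: cayley_cells_def)
    have "finite e" using cayley_cell_card[OF e(1)] by auto
    then show ?thesis using polygonal_paths_cell[OF e cayley_vertex_in_cell] g by blast
  qed
  obtain g h where gh: "g \<in> carrier G" "h \<in> carrier G"
    "polygonal_paths G A p (cayley_vertex g) \<noteq> {}" "polygonal_paths G A q (cayley_vertex h) \<noteq> {}"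
    using * assms by meson
  have "g \<otimes> (inv g \<otimes> h) = h" "inv g \<otimes> h \<in> generate G A"
    using gh assms by (auto simp flip: m_assoc)
  then have "polygonal_paths G A (cayley_vertex g) (cayley_vertex h) \<noteq> {}"
    using polygonal_paths_vertices[of G A "inv g \<otimes> h" g] assms gh by auto
  then show ?thesis using gh polygonal_paths_append(1) polygonal_paths_rev
    by (metis equals0I ex_in_conv)
qed

lemma Metric_space_cayley:
  assumes "group G" "A \<subseteq> carrier G" "generate G A = carrier G"
  shows "Metric_space (cayley_graph G A) (cayley_dist G A)"
proof
  note ne = polygonal_paths_nonempty[OF assms]
  have bdd: "bdd_below (path_length ` X)" for X by (meson bdd_belowI2 path_length_nonneg)
  show nn: "0 \<le> cayley_dist G A x y" for x y
    using ne by (auto simp: cayley_dist_def intro!: cINF_greatest path_length_nonneg)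
  have "path_length ` polygonal_paths G A x y = path_length ` polygonal_paths G A y x" for x y
    using polygonal_paths_rev path_length_rev by (metis (no_types, lifting) image_cong image_eqI subsetI subset_antisym image_subset_iff)
  then show "cayley_dist G A x y = cayley_dist G A y x" for x y
    by (auto simp: cayley_dist_def)
  fix x y assume x: "x \<in> cayley_graph G A" and y: "y \<in> cayley_graph G A"
  show "cayley_dist G A x y = 0 \<longleftrightarrow> x = y"
  proof
    assume 0: "cayley_dist G A x y = 0"
    have "\<bar>x v - y v\<bar> \<le> cayley_dist G A x y" for v
      using x y ne by (auto simp: cayley_dist_def intro!: cINF_greatest coord_le_path_length)
    then show "x = y" using 0 by (auto simp: fun_eq_iff)
  next
    assume "x = y"
    moreover have "[x] \<in> polygonal_paths G A x x" by (simp add: polygonal_paths_def)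
    then have "(INF ps\<in>polygonal_paths G A x x. path_length ps) \<le> path_length [x]"
      by (rule cINF_lower[OF bdd])
    ultimately show "cayley_dist G A x y = 0" using nn[of x x] x by (simp add: cayley_dist_def)
  qed
  fix z assume z: "z \<in> cayley_graph G A"
  have "(INF ps\<in>polygonal_paths G A x z. path_length ps) - path_length qs
     \<le> (INF ps\<in>polygonal_paths G A x y. path_length ps)"
    if "qs \<in> polygonal_paths G A y z" for qs
  proof (rule cINF_greatest[OF ne[OF x y]])
    fix ps assume "ps \<in> polygonal_paths G A x y"
    from cINF_lower[OF bdd polygonal_paths_append(1)[OF this that]] polygonal_paths_append(2)[OF this that]
    show "(INF ps\<in>polygonal_paths G A x z. path_length ps) - path_length qs \<le> path_length ps" by simp
  qed
  then have "(INF ps\<in>polygonal_paths G A x z. path_length ps) - (INF ps\<in>polygonal_paths G A x y. path_length ps)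
     \<le> (INF ps\<in>polygonal_paths G A y z. path_length ps)"
    by (intro cINF_greatest[OF ne[OF y z]]) (simp add: algebra_simps)
  then show "cayley_dist G A x z \<le> cayley_dist G A x y + cayley_dist G A y z"
    using x y z by (simp add: cayley_dist_def)
qed

definition cayley_topology :: "('a, 'b) monoid_scheme \<Rightarrow> 'a set \<Rightarrow> ('a \<Rightarrow> real) topology" where
  "cayley_topology G A = Metric_space.mtopology (cayley_graph G A) (cayley_dist G A)"

text \<open>
  \<open>cayley_nbhd G A k H\<close> is \<open>{x. d (x, H) \<le> k}\<close> for a set \<open>H\<close> of vertices, where \<open>d (x, H)\<close> is
  the infimum of the distances to points of \<open>H\<close> (and \<open>\<infinity>\<close> if \<open>H\<close> is empty).
\<close>

definition cayley_nbhd ::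
    "('a, 'b) monoid_scheme \<Rightarrow> 'a set \<Rightarrow> nat \<Rightarrow> 'a set \<Rightarrow> ('a \<Rightarrow> real) set" where
  "cayley_nbhd G A k H =
     {x \<in> cayley_graph G A.
        H \<noteq> {} \<and> (INF h\<in>H. cayley_dist G A x (cayley_vertex h)) \<le> real k}"


section \<open>Poles and bipolarity\<close>

text \<open>
  A pole is a chain \<open>U\<^sub>1 \<supseteq> U\<^sub>2 \<supseteq> \<dots>\<close> indexed from 1; it is encoded as a sequence indexed from 0,
  \<open>U k\<close> being \<open>U\<^sub>k\<^sub>+\<^sub>1\<close>.  Elements of \<^const>\<open>connected_components_of\<close> are non-empty.
\<close>

definition poles ::
    "('a, 'b) monoid_scheme \<Rightarrow> 'a set \<Rightarrow> 'a set \<Rightarrow> (nat \<Rightarrow> ('a \<Rightarrow> real) set) set" where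
  "poles G A H =
     {U. \<forall>k. U k \<in> connected_components_of
                      (subtopology (cayley_topology G A)
                         (cayley_graph G A - cayley_nbhd G A (Suc k) H))
             \<and> U (Suc k) \<subseteq> U k}"

text \<open>
  The number of poles of \<open>(G, H)\<close> is \<open>n\<close>, computed in the Cayley graph of any finite generating
  set (the number does not depend on this choice).  The finiteness conjunct excludes that an
  infinite set of poles is counted as \<open>0\<close> by \<^const>\<open>card\<close>.
\<close>

definition has_num_poles :: "('a, 'b) monoid_scheme \<Rightarrow> 'a set \<Rightarrow> nat \<Rightarrow> bool" where
  "has_num_poles G H n \<longleftrightarrow>
     finitely_generated G \<and>
     (\<forall>A. finite_generating_set G A \<longrightarrow> finite (poles G A H) \<and> card (poles G A H) = n)"

definition bipolar_element :: "('a, 'b) monoid_scheme \<Rightarrow> 'a \<Rightarrow> bool" where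
  "bipolar_element W s \<longleftrightarrow> has_num_poles W (centraliser W s) 2"

definition bipolar :: "('a, 'b) monoid_scheme \<Rightarrow> bool" where
  "bipolar W \<longleftrightarrow> (\<exists>S. coxeter_generating_set W S \<and> (\<forall>s\<in>S. bipolar_element W s))"

end

theory Submission
  imports Defs
begin

text \<open>
  The argument uses reflections only, no linear representation.  A Coxeter presentation
  attaches to every group element \<open>w\<close> the set \<open>N w\<close> of reflections whose walls separate \<open>1\<close>
  from \<open>w\<close>; this set is a cocycle (\<open>coxeter_reflection_cocycle\<close>), and the exchange condition,
  the behaviour of the word length \<open>len\<close> and the two sides of a wall follow from the cocycle
  rule (locale \<open>reflection_cocycle\<close>).

  Fix \<open>s \<in> S\<close>.  Seen from \<open>w\<close>, the wall of \<open>s\<close> is the wall of the reflection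
  \<open>r = w\<inverse> s w\<close>, and \<open>depth s w = len r\<close> tells how far \<open>w\<close> is from it.  The depth is \<open>1\<close>
  on the centraliser of \<open>s\<close>, it varies by a bounded amount along the edges of any Cayley graph of
  a finite generating set, and every \<open>w\<close> of depth at most \<open>n\<close> lies at bounded distance from the
  centraliser, because only finitely many reflections have length at most \<open>n\<close>
  (\<open>shallow_near_centraliser\<close>).  So the neighbourhoods of the centraliser may be replaced by the
  sublevel sets of the depth, and the theorem follows (\<open>coarse_half_spaces.two_poles\<close>) once two
  things are known about each side of the wall: for every \<open>n\<close> the elements of depth at least
  \<open>n\<close> are connected by edges among themselves, and the depth is unbounded.

  Connectedness (\<open>deep_part_connected\<close>) is a Morse argument.  A step from \<open>w\<close> to \<open>w c\<close>
  replaces \<open>r\<close> by \<open>c r c\<close>, which is longer than \<open>r\<close>, or shorter, or equal to \<open>r\<close>.  Suppose a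
  gallery has depth at least \<open>n\<close>, with both ends deeper, and touches the level \<open>n\<close> at \<open>w\<close>.  As
  \<open>S\<close> is 2-spherical, the residue of \<open>w\<close> spanned by two generators \<open>a\<close>, \<open>b\<close> is a finite cycle,
  and if neither \<open>a\<close> nor \<open>b\<close> leads towards the wall and one of them leads away from it, then \<open>w\<close>
  is a lowest point of this cycle; the only other lowest point can be its neighbour across a
  generator that commutes with \<open>r\<close>
  (\<open>residue_len\<close>, \<open>centralising_in_residue\<close>).  Going round the cycle the other way pushes the
  gallery off the level \<open>n\<close> (\<open>push_path_deeper\<close>).  The induction starts with the half-space.

  Unboundedness (\<open>depth_unbounded\<close>) is where \<open>W\<close> is irreducible and infinite.  If the depth were
  bounded, \<open>s\<close> would have finitely many conjugates.  Finiteness of the conjugacy class passes from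
  \<open>k \<in> S\<close> to every \<open>b \<in> S\<close> that does not commute with \<open>k\<close>: the reflection \<open>w b w\<inverse>\<close> is the only
  one that interchanges the half-spaces of \<open>w k w\<inverse>\<close> and \<open>w (b k b) w\<inverse>\<close> in the way prescribed by
  \<open>w\<close> (\<open>fixes_neighbour\<close>), and there are finitely many such pairs of half-spaces.  By
  irreducibility every element of \<open>S\<close> would have finitely many conjugates; as \<open>S\<close> is finite, there
  would be finitely many reflections in all, and finitely many sets \<open>N w\<close>.  But \<open>w\<close> is determined by \<open>N w\<close>, and \<open>W\<close> is infinite.
\<close>

section \<open>Conjugation in a group\<close>

context group begin

definition conj_by :: "'a \<Rightarrow> 'a \<Rightarrow> 'a" where
  "conj_by x t = x \<otimes> t \<otimes> inv x"

lemma conj_by_closed [simp]: "x \<in> carrier G \<Longrightarrow> t \<in> carrier G \<Longrightarrow> conj_by x t \<in> carrier G"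
  by (simp add: conj_by_def)

lemma mult_inv_cancel [simp]:
  assumes "x \<in> carrier G" "y \<in> carrier G"
  shows "x \<otimes> (inv x \<otimes> y) = y" and "inv x \<otimes> (x \<otimes> y) = y"
  using assms by (simp_all flip: m_assoc)

lemma conj_by_mult:
  "x \<in> carrier G \<Longrightarrow> y \<in> carrier G \<Longrightarrow> t \<in> carrier G \<Longrightarrow> conj_by (x \<otimes> y) t = conj_by x (conj_by y t)"
  by (simp add: conj_by_def m_assoc inv_mult_group)

lemma conj_by_one [simp]: "t \<in> carrier G \<Longrightarrow> conj_by \<one> t = t"
  by (simp add: conj_by_def)

lemma conj_by_inv_cancel [simp]:
  assumes "x \<in> carrier G" "t \<in> carrier G"
  shows "conj_by x (conj_by (inv x) t) = t" and "conj_by (inv x) (conj_by x t) = t"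
  using assms by (simp_all flip: conj_by_mult)

lemma conj_by_eq_iff:
  assumes "x \<in> carrier G" "t \<in> carrier G" "u \<in> carrier G"
  shows "conj_by x t = u \<longleftrightarrow> t = conj_by (inv x) u"
  using assms by auto

lemma conj_by_distrib:
  "x \<in> carrier G \<Longrightarrow> t \<in> carrier G \<Longrightarrow> u \<in> carrier G \<Longrightarrow> conj_by x (t \<otimes> u) = conj_by x t \<otimes> conj_by x u"
  by (simp add: conj_by_def m_assoc)

lemma conj_by_self: "t \<in> carrier G \<Longrightarrow> conj_by t t = t"
  by (simp add: conj_by_def m_assoc)

lemma conj_by_commute_iff:
  assumes "x \<in> carrier G" "t \<in> carrier G"
  shows "conj_by x t = t \<longleftrightarrow> x \<otimes> t = t \<otimes> x"
  using assms by (metis conj_by_def inv_solve_right' m_closed)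

lemma conj_by_commute_sym:
  "x \<in> carrier G \<Longrightarrow> t \<in> carrier G \<Longrightarrow> conj_by x t = t \<longleftrightarrow> conj_by t x = x"
  by (auto simp: conj_by_commute_iff)

lemma conj_by_conj_by:
  "x \<in> carrier G \<Longrightarrow> t \<in> carrier G \<Longrightarrow> u \<in> carrier G \<Longrightarrow>
    conj_by (conj_by x t) u = conj_by x (conj_by t (conj_by (inv x) u))"
  by (simp add: conj_by_def m_assoc inv_mult_group)

lemma inv_eq_self: "x \<in> carrier G \<Longrightarrow> x \<otimes> x = \<one> \<Longrightarrow> inv x = x"
  using inv_equality by blast

end

section \<open>Words, walls and the exchange condition\<close>

text \<open>
  \<open>N x\<close> is to be read as the set of reflections whose walls separate
  \<open>1\<close> from \<open>x\<close>. The cocycle rule \<open>N_mult\<close> joins a gallery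
  from \<open>1\<close> to \<open>x\<close> with the translate by \<open>x\<close> of one from
  \<open>1\<close> to \<open>y\<close>: a wall separates the ends if exactly one of the two
  parts crosses it an odd number of times, and the wall of \<open>t\<close> is the wall of
  \<open>x\<inverse> t x\<close> when seen from \<open>x\<close>.
\<close>

locale reflection_cocycle = group G for G (structure) +
  fixes S :: "'a set" and N :: "'a \<Rightarrow> 'a set"
  assumes S_carrier: "S \<subseteq> carrier G"
    and S_square: "s \<in> S \<Longrightarrow> s \<otimes> s = \<one>"
    and S_generate: "generate G S = carrier G"
    and N_carrier: "x \<in> carrier G \<Longrightarrow> N x \<subseteq> carrier G"
    and N_gen: "s \<in> S \<Longrightarrow> N s = {s}"
    and N_mult: "x \<in> carrier G \<Longrightarrow> y \<in> carrier G \<Longrightarrow> t \<in> carrier G \<Longrightarrow>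
      t \<in> N (x \<otimes> y) \<longleftrightarrow> (t \<in> N x) \<noteq> (conj_by (inv x) t \<in> N y)"
begin

lemma S_in [simp, intro]: "s \<in> S \<Longrightarrow> s \<in> carrier G" using S_carrier by auto

lemma S_inv [simp]: "s \<in> S \<Longrightarrow> inv s = s" by (simp add: S_square inv_eq_self)

lemma S_cancel [simp]: "s \<in> S \<Longrightarrow> x \<in> carrier G \<Longrightarrow> s \<otimes> (s \<otimes> x) = x"
  using mult_inv_cancel(1)[of s x] by simp

lemma S_cancel_right [simp]: "s \<in> S \<Longrightarrow> x \<in> carrier G \<Longrightarrow> x \<otimes> s \<otimes> s = x"
  by (simp add: m_assoc S_square)

lemma N_in: "t \<in> N x \<Longrightarrow> x \<in> carrier G \<Longrightarrow> t \<in> carrier G" using N_carrier by auto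

lemma N_one [simp]: "N \<one> = {}"
  using N_mult[of \<one> \<one>] N_in[of _ \<one>] by auto

lemma S_not_one [simp]: "s \<in> S \<Longrightarrow> s \<noteq> \<one>" using N_gen N_one by force

lemma N_inv: "x \<in> carrier G \<Longrightarrow> t \<in> carrier G \<Longrightarrow> t \<in> N (inv x) \<longleftrightarrow> conj_by x t \<in> N x"
  using N_mult[of "inv x" x t] by simp

lemma N_gen_mult: "a \<in> S \<Longrightarrow> x \<in> carrier G \<Longrightarrow> t \<in> carrier G \<Longrightarrow>
    t \<in> N (a \<otimes> x) \<longleftrightarrow> (t = a) \<noteq> (conj_by a t \<in> N x)"
  by (simp add: N_mult N_gen)

lemma N_mult_gen: "a \<in> S \<Longrightarrow> x \<in> carrier G \<Longrightarrow> t \<in> carrier G \<Longrightarrow>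
    t \<in> N (x \<otimes> a) \<longleftrightarrow> (t \<in> N x) \<noteq> (t = conj_by x a)"
  by (auto simp: N_mult N_gen conj_by_eq_iff)

definition word_prod :: "'a list \<Rightarrow> 'a" where
  "word_prod ws = foldr (\<otimes>) ws \<one>"

lemma word_prod_simps [simp]:
  "word_prod [] = \<one>" "word_prod (a # ws) = a \<otimes> word_prod ws"
  by (simp_all add: word_prod_def)

lemma word_prod_closed [simp]: "set ws \<subseteq> S \<Longrightarrow> word_prod ws \<in> carrier G"
  by (induction ws) auto

lemma word_prod_append [simp]:
  "set us \<subseteq> S \<Longrightarrow> set vs \<subseteq> S \<Longrightarrow> word_prod (us @ vs) = word_prod us \<otimes> word_prod vs"
  by (induction us) (auto simp: m_assoc)

lemma word_prod_rev: "set ws \<subseteq> S \<Longrightarrow> word_prod (rev ws) = inv (word_prod ws)"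
  by (induction ws) (auto simp: inv_mult_group)

lemma generate_word:
  assumes "S0 \<subseteq> S" "x \<in> generate G S0"
  shows "\<exists>ws. set ws \<subseteq> S0 \<and> word_prod ws = x"
  using assms(2)
proof (induction rule: generate.induct)
  case one
  show ?case by (rule exI[of _ "[]"]) auto
next
  case (incl h)
  with assms(1) show ?case by (intro exI[of _ "[h]"]) auto
next
  case (inv h)
  with assms(1) have "h \<in> S" by auto
  with inv show ?case by (intro exI[of _ "[h]"]) auto
next
  case (eng h1 h2)
  then obtain us vs where "set us \<subseteq> S0" "word_prod us = h1" "set vs \<subseteq> S0" "word_prod vs = h2" by auto
  then show ?case using assms(1) by (intro exI[of _ "us @ vs"]) auto
qed

lemma word_in_generate:
  assumes "set ws \<subseteq> S0" shows "word_prod ws \<in> generate G S0"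
  using assms by (induction ws) (auto intro: generate.intros)

lemma ex_word: "x \<in> carrier G \<Longrightarrow> \<exists>ws. set ws \<subseteq> S \<and> word_prod ws = x"
  using generate_word[of S] S_generate by simp

text \<open>
  Every wall separating \<open>1\<close> from the end of a gallery is crossed by one of its
  steps; the step with letter \<open>s\<close> after the prefix \<open>us\<close> crosses the
  wall of \<open>us s us\<inverse>\<close>.
\<close>

lemma exchange:
  assumes "set ws \<subseteq> S" "t \<in> N (word_prod ws)"
  shows "\<exists>us s vs. ws = us @ s # vs \<and> t = conj_by (word_prod us) s"
  using assms
proof (induction ws arbitrary: t)
  case (Cons a ws)
  then have t: "t \<in> carrier G" and a: "a \<in> S" by (auto intro: N_in[of _ "word_prod (a # ws)"])
  show ?case
  proof (cases "t = a")
    case True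
    then show ?thesis using t by (intro exI[of _ "[]"]) auto
  next
    case False
    then have "conj_by a t \<in> N (word_prod ws)" using Cons.prems a t by (simp add: N_gen_mult)
    then obtain us s vs where *: "ws = us @ s # vs" "conj_by a t = conj_by (word_prod us) s"
      using Cons.IH[of "conj_by a t"] Cons.prems by auto
    then have "t = conj_by a (conj_by (word_prod us) s)"
      using a t conj_by_inv_cancel(1)[of a t] by simp
    also have "\<dots> = conj_by (word_prod (a # us)) s" using * Cons.prems by (simp add: conj_by_mult)
    finally show ?thesis using * by (intro exI[of _ "a # us"]) auto
  qed
qed auto

lemma exchange_delete:
  assumes "set (us @ s # vs) \<subseteq> S"
  shows "conj_by (word_prod us) s \<otimes> word_prod (us @ s # vs) = word_prod (us @ vs)"
  using assms by (simp add: conj_by_def m_assoc)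

text \<open>
  All walls crossed by a gallery that uses letters of \<open>S0\<close> belong to reflections in
  the group generated by \<open>S0\<close>.
\<close>

lemma N_subset_generate:
  assumes "S0 \<subseteq> S" "x \<in> generate G S0"
  shows "N x \<subseteq> generate G S0"
proof
  fix t assume t: "t \<in> N x"
  have sub: "subgroup (generate G S0) G" using assms by (intro generate_is_subgroup) auto
  obtain ws where ws: "set ws \<subseteq> S0" "word_prod ws = x" using generate_word assms by blast
  then have "set ws \<subseteq> S" using assms by auto
  then obtain us s vs where "ws = us @ s # vs" "t = conj_by (word_prod us) s"
    using exchange[of ws t] t ws by auto
  moreover from this have "word_prod us \<in> generate G S0" "s \<in> generate G S0"
    using ws word_in_generate[of us S0] by (auto intro: generate.incl)
  ultimately show "t \<in> generate G S0"
    using sub by (simp add: conj_by_def subgroup.m_closed subgroup.m_inv_closed)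
qed

text \<open>
  If the first letter \<open>a\<close> of a word in \<open>S0\<close> is not a descent, then the
  wall of \<open>a\<close> is crossed once more by the rest of the word, and exchange yields a
  shorter word in \<open>S0\<close> for the same element.
\<close>

lemma ex_descent:
  assumes "S0 \<subseteq> S" "u \<in> generate G S0" "u \<noteq> \<one>"
  shows "\<exists>a\<in>S0. a \<in> N u"
proof -
  have "word_prod ws \<noteq> \<one> \<Longrightarrow> \<exists>a\<in>S0. a \<in> N (word_prod ws)" if "set ws \<subseteq> S0" for ws
    using that
  proof (induction "length ws" arbitrary: ws rule: less_induct)
    case less
    show ?case
    proof (cases ws)
      case Nil
      then show ?thesis using less by auto
    next
      case (Cons a vs)
      have S: "set vs \<subseteq> S" "a \<in> S" using Cons less assms by auto
      have aN: "a \<in> N (word_prod ws) \<longleftrightarrow> a \<notin> N (word_prod vs)"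
        using S Cons by (simp add: N_gen_mult conj_by_self)
      show ?thesis
      proof (cases "a \<in> N (word_prod vs)")
        case False
        then show ?thesis using aN Cons less by auto
      next
        case True
        obtain us s us' where *: "vs = us @ s # us'" "a = conj_by (word_prod us) s"
          using exchange[OF S(1) True] by blast
        then have "word_prod ws = word_prod (us @ us')"
          using exchange_delete[of us s us'] S Cons by simp
        moreover have "length (us @ us') < length ws" "set (us @ us') \<subseteq> S0"
          using * Cons less by auto
        ultimately show ?thesis using less by metis
      qed
    qed
  qed
  then show ?thesis using generate_word assms by metis
qed

lemma N_empty_imp_one: "x \<in> carrier G \<Longrightarrow> N x = {} \<Longrightarrow> x = \<one>"
  using ex_descent[of S x] S_generate by auto

lemma N_inj: "inj_on N (carrier G)"
proof (rule inj_onI)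
  fix x y assume xy: "x \<in> carrier G" "y \<in> carrier G" "N x = N y"
  have "N (inv x \<otimes> y) = {}"
  proof safe
    fix t assume t: "t \<in> N (inv x \<otimes> y)"
    then have "t \<in> carrier G" using N_in[of _ "inv x \<otimes> y"] xy by auto
    then show "t \<in> {}" using t xy by (simp add: N_mult N_inv)
  qed
  then have "inv x \<otimes> y = \<one>" using xy N_empty_imp_one by auto
  then show "x = y" using xy by (metis inv_solve_left' m_closed one_closed r_one inv_closed)
qed

definition len :: "'a \<Rightarrow> nat" where
  "len x = (LEAST n. \<exists>ws. set ws \<subseteq> S \<and> length ws = n \<and> word_prod ws = x)"

lemma reduced_word:
  assumes "x \<in> carrier G"
  shows "\<exists>ws. set ws \<subseteq> S \<and> length ws = len x \<and> word_prod ws = x"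
proof -
  have "\<exists>n ws. set ws \<subseteq> S \<and> length ws = n \<and> word_prod ws = x" using ex_word assms by auto
  then show ?thesis unfolding len_def by (rule LeastI_ex)
qed

lemma len_word_le: "set ws \<subseteq> S \<Longrightarrow> len (word_prod ws) \<le> length ws"
  unfolding len_def by (rule Least_le) auto

lemma len_one [simp]: "len \<one> = 0" using len_word_le[of "[]"] by simp

lemma len_mult_le:
  assumes "x \<in> carrier G" "y \<in> carrier G" shows "len (x \<otimes> y) \<le> len x + len y"
proof -
  obtain us vs where "set us \<subseteq> S" "length us = len x" "word_prod us = x"
    "set vs \<subseteq> S" "length vs = len y" "word_prod vs = y" using reduced_word assms by meson
  then show ?thesis using len_word_le[of "us @ vs"] by simp
qed

lemma len_inv [simp]: assumes "x \<in> carrier G" shows "len (inv x) = len x"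
proof -
  have "len (inv x) \<le> len x" if x: "x \<in> carrier G" for x
  proof -
    obtain us where "set us \<subseteq> S" "length us = len x" "word_prod us = x" using reduced_word x by meson
    then show ?thesis using len_word_le[of "rev us"] by (simp add: word_prod_rev)
  qed
  from this[of x] this[of "inv x"] show ?thesis using assms by simp
qed

lemma len_eq_0: "x \<in> carrier G \<Longrightarrow> len x = 0 \<longleftrightarrow> x = \<one>"
  using reduced_word[of x] by auto

lemma len_gen: "a \<in> S \<Longrightarrow> len a = 1"
  using len_word_le[of "[a]"] len_eq_0[of a] by (auto simp: le_Suc_eq)

lemma N_len_less: assumes "x \<in> carrier G" "t \<in> N x" shows "len (t \<otimes> x) < len x"
proof -
  obtain ws where ws: "set ws \<subseteq> S" "length ws = len x" "word_prod ws = x" using reduced_word assms by meson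
  obtain us s vs where *: "ws = us @ s # vs" "t = conj_by (word_prod us) s"
    using exchange[of ws t] ws assms by auto
  then have "t \<otimes> x = word_prod (us @ vs)" using exchange_delete[of us s vs] ws by simp
  then show ?thesis using len_word_le[of "us @ vs"] ws * by simp
qed

section \<open>Lengths of reflections\<close>

definition reflection :: "'a \<Rightarrow> bool" where
  "reflection t \<longleftrightarrow> (\<exists>x\<in>carrier G. \<exists>s\<in>S. t = conj_by x s)"

lemma reflection_in: "reflection t \<Longrightarrow> t \<in> carrier G" by (auto simp: reflection_def)

lemma reflection_gen: "s \<in> S \<Longrightarrow> reflection s" unfolding reflection_def by (metis S_in conj_by_one one_closed)

lemma reflection_conj: "reflection t \<Longrightarrow> x \<in> carrier G \<Longrightarrow> reflection (conj_by x t)"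
  unfolding reflection_def by (metis S_in conj_by_mult m_closed)

lemma N_reflection: assumes "x \<in> carrier G" "t \<in> N x" shows "reflection t"
proof -
  obtain ws where ws: "set ws \<subseteq> S" "word_prod ws = x" using ex_word assms by blast
  then obtain us s vs where "ws = us @ s # vs" "t = conj_by (word_prod us) s"
    using exchange assms by blast
  then show ?thesis using ws by (auto simp: reflection_def)
qed

lemma reflection_square: "reflection t \<Longrightarrow> t \<otimes> t = \<one>"
  unfolding reflection_def
  by (metis S_in S_square conj_by_def conj_by_distrib inv_closed one_closed r_inv r_one)

lemma reflection_inv [simp]: "reflection t \<Longrightarrow> inv t = t"
  by (simp add: inv_eq_self reflection_in reflection_square)

text \<open>
  A gallery from \<open>1\<close> to \<open>x c x\<inverse>\<close> is obtained by going to
  \<open>x\<close>, crossing the wall of \<open>x c x\<inverse>\<close>, and returning along the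
  mirror image of the way to \<open>x\<close>.
\<close>

lemma N_conj:
  assumes "x \<in> carrier G" "c \<in> S" "t \<in> carrier G"
  shows "t \<in> N (conj_by x c) \<longleftrightarrow>
    ((t \<in> N x) \<noteq> (t = conj_by x c)) \<noteq> (conj_by (conj_by x c) t \<in> N x)"
proof -
  have "t \<in> N (conj_by x c) \<longleftrightarrow> (t \<in> N (x \<otimes> c)) \<noteq> (conj_by (inv (x \<otimes> c)) t \<in> N (inv x))"
    using assms N_mult[of "x \<otimes> c" "inv x" t] by (simp add: conj_by_def)
  also have "conj_by (inv (x \<otimes> c)) t \<in> N (inv x) \<longleftrightarrow> conj_by x (conj_by (inv (x \<otimes> c)) t) \<in> N x"
    using assms by (simp add: N_inv)
  also have "conj_by x (conj_by (inv (x \<otimes> c)) t) = conj_by (conj_by x c) t"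
    using assms by (simp add: conj_by_def inv_mult_group m_assoc)
  also have "t \<in> N (x \<otimes> c) \<longleftrightarrow> (t \<in> N x) \<noteq> (t = conj_by x c)"
    using assms by (simp add: N_mult_gen)
  finally show ?thesis .
qed

lemma reflection_in_N_self: assumes "reflection t" shows "t \<in> N t"
proof -
  obtain x c where "x \<in> carrier G" "c \<in> S" "t = conj_by x c" using assms by (auto simp: reflection_def)
  then show ?thesis using N_conj[of x c t] by (simp add: conj_by_self)
qed

lemma N_iff_len:
  assumes "reflection t" "x \<in> carrier G"
  shows "t \<in> N x \<longleftrightarrow> len (t \<otimes> x) < len x"
proof
  assume "t \<in> N x" then show "len (t \<otimes> x) < len x" using N_len_less assms by blast
next
  assume *: "len (t \<otimes> x) < len x"
  have t: "t \<in> carrier G" using assms reflection_in by blast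
  show "t \<in> N x"
  proof (rule ccontr)
    assume "t \<notin> N x"
    then have "t \<in> N (t \<otimes> x)"
      using assms t by (simp add: N_mult reflection_in_N_self conj_by_self)
    then have "len (t \<otimes> (t \<otimes> x)) < len (t \<otimes> x)" using N_len_less assms t by blast
    then show False using * assms t reflection_square by (simp flip: m_assoc)
  qed
qed

lemma len_less_right:
  assumes "reflection t" "x \<in> carrier G"
  shows "t \<in> N (inv x) \<longleftrightarrow> len (x \<otimes> t) < len x"
proof -
  have t: "t \<in> carrier G" using assms reflection_in by blast
  have "t \<otimes> inv x = inv (x \<otimes> t)" using assms t by (simp add: inv_mult_group)
  then show ?thesis using N_iff_len[of t "inv x"] assms t by simp
qed

text \<open>
  \<open>t\<close> separates \<open>1\<close> from exactly one of \<open>x\<close> and \<open>t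
  x\<close>, and that one is the longer.
\<close>

lemma len_reflection_mult_neq:
  assumes "reflection t" "x \<in> carrier G" shows "len (t \<otimes> x) \<noteq> len x"
proof
  assume *: "len (t \<otimes> x) = len x"
  have t: "t \<in> carrier G" using assms reflection_in by blast
  have "t \<in> N x \<longleftrightarrow> t \<notin> N (t \<otimes> x)" using assms t by (simp add: N_mult reflection_in_N_self conj_by_self)
  moreover have "t \<otimes> (t \<otimes> x) = x" using assms t reflection_square by (simp flip: m_assoc)
  ultimately show False using * N_iff_len[of t x] N_iff_len[of t "t \<otimes> x"] assms t by auto
qed

lemma N_len_bound:
  assumes "x \<in> carrier G" "t \<in> N x" shows "len t < 2 * len x"
proof -
  obtain ws where ws: "set ws \<subseteq> S" "length ws = len x" "word_prod ws = x" using reduced_word assms by meson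
  obtain us s vs where *: "ws = us @ s # vs" "t = conj_by (word_prod us) s"
    using exchange[of ws t] ws assms by auto
  then have "t = word_prod (us @ s # rev us)" using ws by (simp add: conj_by_def m_assoc word_prod_rev)
  then have "len t \<le> 2 * length us + 1" using len_word_le[of "us @ s # rev us"] ws * by auto
  then show ?thesis using ws * by auto
qed

text \<open>
  A reduced word of \<open>r\<close> crosses the wall of \<open>r\<close> at some letter
  \<open>c\<close>. Deleting this letter gives a word for \<open>r r = 1\<close>, so the parts
  before and after \<open>c\<close> are inverse to each other and have equal length.
\<close>

lemma reflection_palindrome:
  assumes "reflection r"
  shows "\<exists>u\<in>carrier G. \<exists>c\<in>S. r = conj_by u c \<and> len r = 2 * len u + 1"
proof -
  have r: "r \<in> carrier G" using assms reflection_in by blast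
  obtain ws where ws: "set ws \<subseteq> S" "length ws = len r" "word_prod ws = r" using reduced_word r by meson
  obtain us c vs where *: "ws = us @ c # vs" "r = conj_by (word_prod us) c"
    using exchange[of ws r] ws reflection_in_N_self assms by auto
  then have S: "set us \<subseteq> S" "c \<in> S" "set vs \<subseteq> S" using ws by auto
  have "word_prod (us @ vs) = \<one>" using exchange_delete[of us c vs] ws * reflection_square[OF assms] by simp
  then have inv: "word_prod us = inv (word_prod vs)" using S by (simp add: inv_equality)
  have "len r = length us + 1 + length vs" using ws * by simp
  moreover have red: "len (word_prod us) \<le> length us" "len (word_prod vs) \<le> length vs"
    using S len_word_le by auto
  moreover have "len (word_prod us) = len (word_prod vs)" using inv S by simp
  moreover have "len r \<le> len (word_prod us) + 1 + len (word_prod us)"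
  proof -
    have "len r \<le> len (word_prod us \<otimes> c) + len (inv (word_prod us))"
      using * S len_mult_le[of "word_prod us \<otimes> c" "inv (word_prod us)"] by (simp add: conj_by_def)
    also have "\<dots> \<le> len (word_prod us) + len c + len (word_prod us)"
      using len_mult_le[of "word_prod us" c] S by simp
    finally show ?thesis using len_gen S by simp
  qed
  ultimately show ?thesis using * S by (intro bexI[of _ "word_prod us"] bexI[of _ c]) auto
qed

text \<open>
  A wall that separates \<open>1\<close> from \<open>r\<close> and is not that of
  \<open>r\<close> is crossed in the first half of a palindromic reduced word of
  \<open>r\<close>, or else its mirror image is; a wall crossed in the first half has a short
  reflection.
\<close>

lemma N_reflection_len:
  assumes "reflection r" "t \<in> N r" "t \<noteq> r"
  shows "len t < len r \<or> len (conj_by r t) < len r"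
proof -
  obtain u c where u: "u \<in> carrier G" "c \<in> S" "r = conj_by u c" "len r = 2 * len u + 1"
    using reflection_palindrome assms by blast
  have t: "t \<in> carrier G" using assms reflection_in N_in by blast
  then have "t \<in> N u \<or> conj_by r t \<in> N u" using N_conj[OF u(1,2) t] assms u by auto
  then show ?thesis using N_len_bound u by fastforce
qed

text \<open>
  If \<open>t\<close> commutes with \<open>r\<close>, the two outer terms of
  \<open>N_conj\<close> cancel.
\<close>

lemma commuting_descent:
  assumes "reflection r" "t \<in> carrier G" "conj_by r t = t"
  shows "t \<in> N r \<longleftrightarrow> t = r"
proof -
  obtain u c where u: "u \<in> carrier G" "c \<in> S" "r = conj_by u c" using assms(1) by (auto simp: reflection_def)
  then show ?thesis using N_conj[OF u(1,2) assms(2)] assms by auto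
qed

text \<open>
  In terms of roots: if \<open>r\<close> is the reflection in the positive root
  \<open>\<beta>\<close>, then \<open>a\<close> moves \<open>\<beta>\<close> up, moves it down
  or fixes it, according to the sign of the inner product of \<open>\<beta>\<close> with the
  simple root of \<open>a\<close>.
\<close>

lemma len_conj_gen:
  assumes "reflection r" "a \<in> S" "conj_by a r \<noteq> r"
  shows "a \<in> N r \<Longrightarrow> len (conj_by a r) < len r" and "a \<notin> N r \<Longrightarrow> len r < len (conj_by a r)"
proof -
  have r: "r \<in> carrier G" using assms reflection_in by blast
  have nc: "conj_by r a \<noteq> a" using assms r conj_by_commute_sym[of a r] by auto
  have ra: "inv (a \<otimes> r) = r \<otimes> a" using assms r by (simp add: inv_mult_group)
  have eq: "conj_by a r = a \<otimes> (r \<otimes> a)" using assms r by (simp add: conj_by_def m_assoc)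
  have len: "len (r \<otimes> a) = len (a \<otimes> r)" using ra assms r len_inv[of "a \<otimes> r"] by simp
  have *: "a \<in> N (r \<otimes> a) \<longleftrightarrow> a \<in> N r" using nc assms r by (auto simp: N_mult_gen)
  {
    assume "a \<in> N r"
    then have "len (a \<otimes> r) < len r" using N_iff_len reflection_gen assms r by blast
    moreover have "len (conj_by a r) < len (r \<otimes> a)"
      using * \<open>a \<in> N r\<close> N_iff_len[of a "r \<otimes> a"] reflection_gen assms r eq by simp
    ultimately show "len (conj_by a r) < len r" using len by simp
  }
  {
    assume "a \<notin> N r"
    then have "len (a \<otimes> r) > len r"
      using N_iff_len[of a r] reflection_gen assms r len_reflection_mult_neq[of a r] by auto
    moreover have "len (conj_by a r) > len (r \<otimes> a)"
      using * \<open>a \<notin> N r\<close> N_iff_len[of a "r \<otimes> a"] len_reflection_mult_neq[of a "r \<otimes> a"] reflection_gen assms r eq by force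
    ultimately show "len r < len (conj_by a r)" using len by simp
  }
qed

text \<open>
  A reflection that exchanges two walls of the fundamental chamber, and has the chambers across
  them on its positive side, would have a wall that cuts through the interior of the chamber.
  Combinatorially: the wall of \<open>b r b\<close> separates \<open>1\<close> from
  \<open>r\<close>, and its mirror image under \<open>r\<close> is the wall of \<open>a r
  a\<close>; one of these reflections must be shorter than \<open>r\<close> by
  \<open>N_reflection_len\<close>, but conjugation by \<open>a\<close> and by \<open>b\<close>
  lengthens \<open>r\<close>.
\<close>

lemma no_swap:
  assumes "reflection r" "a \<in> S" "b \<in> S" "a \<notin> N r" "b \<notin> N r" "conj_by r a = b"
  shows "a = b"
proof (rule ccontr)
  assume ab: "a \<noteq> b"
  have r: "r \<in> carrier G" using assms reflection_in by blast
  note inv = reflection_inv[OF assms(1)]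
  have rb: "conj_by r b = a" using conj_by_eq_iff[of r a b] assms r by simp
  have rneq: "r \<noteq> b" using assms reflection_in_N_self[OF assms(1)] by auto
  let ?t = "conj_by b r"
  have t: "?t \<in> carrier G" using assms r by simp
  have eq: "r \<otimes> a = b \<otimes> r" using assms(6) r assms(2) by (auto simp: conj_by_def m_assoc)
  have ncb: "conj_by b r \<noteq> r" using conj_by_commute_sym[of b r] rb ab assms r by auto
  have nca: "conj_by a r \<noteq> r" using conj_by_commute_sym[of a r] ab assms r by auto
  have "?t \<in> N (b \<otimes> r)"
  proof -
    have "?t \<noteq> b"
    proof
      assume "?t = b"
      then have "r = conj_by b b" using conj_by_eq_iff[of b r b] assms r by simp
      then show False using rneq conj_by_self[of b] assms by simp
    qed
    moreover have "conj_by b ?t = r" using conj_by_inv_cancel(1)[of b r] assms r by simp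
    ultimately show ?thesis using N_gen_mult[of b r ?t] assms r reflection_in_N_self t by simp
  qed
  moreover have rtr: "conj_by r ?t = conj_by a r"
  proof -
    have "conj_by r (conj_by b r) = conj_by (r \<otimes> b) r" using assms r by (simp add: conj_by_mult)
    also have "r \<otimes> b = a \<otimes> r" using rb r assms(3) inv reflection_square[OF assms(1)] by (auto simp: conj_by_def m_assoc)
    also have "conj_by (a \<otimes> r) r = conj_by a r" using assms r by (simp add: conj_by_mult conj_by_self)
    finally show ?thesis .
  qed
  moreover have "conj_by a r \<noteq> a"
  proof
    assume "conj_by a r = a"
    then have "r = conj_by a a" using conj_by_eq_iff[of a r a] assms r by simp
    then show False using conj_by_self[of a] assms reflection_in_N_self[OF assms(1)] by simp
  qed
  ultimately have "?t \<in> N r"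
    using N_mult_gen[of a r ?t] eq assms r t
      conj_by_eq_iff[of r a ?t] conj_by_eq_iff[of r ?t a] inv by auto
  moreover have "len r < len ?t" "len r < len (conj_by r ?t)"
    using len_conj_gen(2)[of r] assms ncb nca rtr by auto
  ultimately show False using N_reflection_len[OF assms(1), of ?t] ncb by auto
qed

section \<open>Rank two residues\<close>

lemma generate_subgroup: "S0 \<subseteq> S \<Longrightarrow> subgroup (generate G S0) G"
  by (intro generate_is_subgroup) auto

lemma generate_in: "S0 \<subseteq> S \<Longrightarrow> x \<in> generate G S0 \<Longrightarrow> x \<in> carrier G"
  using generate_subgroup subgroup.subset by blast

lemma generate_conj:
  "S0 \<subseteq> S \<Longrightarrow> x \<in> generate G S0 \<Longrightarrow> y \<in> generate G S0 \<Longrightarrow> conj_by x y \<in> generate G S0"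
  unfolding conj_by_def using generate_subgroup by (simp add: subgroup.m_closed subgroup.m_inv_closed)

text \<open>
  An element without descents in \<open>S0\<close> is the shortest in its coset of the parabolic
  subgroup generated by \<open>S0\<close>: otherwise write \<open>r = v q\<close> with
  \<open>q\<close> the shortest; a descent of \<open>v\<close> would be a descent of
  \<open>r\<close>.
\<close>

lemma N_disjoint_generate:
  assumes "S0 \<subseteq> S" "r \<in> carrier G" "\<And>a. a \<in> S0 \<Longrightarrow> a \<notin> N r"
  shows "N r \<inter> generate G S0 = {}"
proof -
  let ?D = "generate G S0"
  note sub = generate_subgroup[OF assms(1)] and D_in = generate_in[OF assms(1)]
  obtain u where u: "u \<in> ?D" "\<And>v. v \<in> ?D \<Longrightarrow> len (u \<otimes> r) \<le> len (v \<otimes> r)"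
    using ex_has_least_nat[of "\<lambda>u. u \<in> ?D" \<one> "\<lambda>u. len (u \<otimes> r)"] by (auto intro: generate.one)
  let ?q = "u \<otimes> r"
  have q: "?q \<in> carrier G" using u D_in assms by auto
  have disj: "N ?q \<inter> ?D = {}"
  proof safe
    fix t assume t: "t \<in> N ?q" "t \<in> ?D"
    then have "len (t \<otimes> ?q) < len ?q" using N_len_less q by blast
    moreover have "t \<otimes> ?q = (t \<otimes> u) \<otimes> r" using t u D_in assms by (simp add: m_assoc)
    moreover have "t \<otimes> u \<in> ?D" using t u by (auto intro: generate.eng)
    ultimately show "t \<in> {}" using u(2)[of "t \<otimes> u"] by auto
  qed
  have v: "inv u \<in> ?D" using u sub by (simp add: subgroup.m_inv_closed)
  have r: "r = inv u \<otimes> ?q" using u D_in assms by simp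
  have "inv u = \<one>"
  proof (rule ccontr)
    assume "inv u \<noteq> \<one>"
    then obtain a where a: "a \<in> S0" "a \<in> N (inv u)" using ex_descent[OF assms(1) v] by auto
    then have aD: "a \<in> ?D" "a \<in> carrier G" using assms by (auto intro: generate.incl)
    have "conj_by u a \<notin> N ?q" using generate_conj[OF assms(1) u(1) aD(1)] disj by auto
    then have "a \<in> N (inv u \<otimes> ?q)" using a aD u D_in q by (simp add: N_mult)
    then show False using r assms(3) a by auto
  qed
  then have "?q = r" using r q u D_in by auto
  then show ?thesis using disj by simp
qed

text \<open>
  The equation \<open>q z = z r\<close> transports a descent \<open>x\<close> of
  \<open>z\<close>: it is a descent of \<open>z r\<close>, hence of \<open>q z\<close>, so
  \<open>y = q x q\<close> lies in the parabolic subgroup. The same comparison for \<open>q y =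
  x q\<close> shows that a descent of \<open>y\<close> can only be \<open>y\<close> itself, that
  is, \<open>y\<close> is again a generator.
\<close>

lemma minimal_conj_commutes:
  assumes "S0 \<subseteq> S" "reflection r" "reflection q"
    and "\<And>a. a \<in> S0 \<Longrightarrow> a \<notin> N r" "\<And>a. a \<in> S0 \<Longrightarrow> a \<notin> N q"
    and "z \<in> generate G S0" "z \<noteq> \<one>" "conj_by z r = q"
  shows "\<exists>x\<in>S0. x \<in> N z \<and> conj_by q x \<in> S0"
proof -
  let ?D = "generate G S0"
  note sub = generate_subgroup[OF assms(1)] and D_in = generate_in[OF assms(1)]
  have r: "r \<in> carrier G" and q: "q \<in> carrier G" using assms reflection_in by auto
  note qinv = reflection_inv[OF assms(3)]
  have z: "z \<in> carrier G" using D_in assms by auto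
  have disj: "N r \<inter> ?D = {}" "N q \<inter> ?D = {}" using N_disjoint_generate assms r q by auto
  obtain x where x: "x \<in> S0" "x \<in> N z" using ex_descent assms by blast
  then have xD: "x \<in> ?D" and xS: "x \<in> S" "x \<in> carrier G" using assms by (auto intro: generate.incl)
  have "inv z \<in> ?D" using assms sub by (simp add: subgroup.m_inv_closed)
  then have "conj_by (inv z) x \<notin> N r" using generate_conj[OF assms(1) _ xD] disj by auto
  then have "x \<in> N (z \<otimes> r)" using x xS z r by (simp add: N_mult)
  moreover have "z \<otimes> r = q \<otimes> z" using assms(8) z r by (auto simp: conj_by_def m_assoc)
  ultimately have yN: "conj_by q x \<in> N z"
    using N_mult[of q z x] xS q z qinv assms(5)[OF x(1)] by simp
  define y where "y = conj_by q x"
  have y: "y \<in> ?D" "y \<in> carrier G" using yN N_subset_generate assms q xS by (auto simp: y_def)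
  have xy: "x = conj_by q y" using y_def q xS qinv conj_by_inv_cancel(1)[of q x] by simp
  have "y \<noteq> \<one>"
  proof
    assume "y = \<one>"
    then have "x = \<one>" using xy q by (simp add: conj_by_def)
    then show False using S_not_one[OF xS(1)] by blast
  qed
  then obtain a where a: "a \<in> S0" "a \<in> N y" using ex_descent[OF assms(1) y(1)] by auto
  then have aD: "a \<in> ?D" "a \<in> S" "a \<in> carrier G" using assms by (auto intro: generate.incl)
  have "conj_by q a \<notin> N q" using N_inv[of q a] aD q qinv assms(5)[OF a(1)] by simp
  then have "conj_by q a \<in> N (q \<otimes> y)"
    using N_mult[of q y "conj_by q a"] a aD q y qinv conj_by_inv_cancel(2)[of q a] by simp
  moreover have "q \<otimes> y = x \<otimes> q" using y_def q xS qinv reflection_square[OF assms(3)]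
    by (simp add: conj_by_def flip: m_assoc)
  ultimately have cases: "conj_by q a = x \<or> conj_by x (conj_by q a) \<in> N q"
    using N_gen_mult[of x q "conj_by q a"] xS aD q by auto
  have "conj_by x (conj_by q a) \<notin> N q"
  proof
    assume *: "conj_by x (conj_by q a) \<in> N q"
    have "conj_by q (conj_by x (conj_by q a)) = conj_by y a"
      unfolding y_def using conj_by_conj_by[of q x a] aD xS q qinv by simp
    moreover have "conj_by q (conj_by x (conj_by q a)) \<in> N q"
      using * N_inv[of q "conj_by x (conj_by q a)"] qinv q xS aD by simp
    moreover have "conj_by y a \<in> ?D" using generate_conj[OF assms(1) y(1) aD(1)] .
    ultimately show False using disj by auto
  qed
  then have "a = y" using cases y_def aD q qinv conj_by_inv_cancel(2)[of q a] by auto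
  then show ?thesis using x a y_def by auto
qed

text \<open>
  By \<open>no_swap\<close> the descent \<open>x\<close> of \<open>z\<close> found in
  \<open>minimal_conj_commutes\<close> commutes with \<open>q\<close>, so it may be removed from
  \<open>z\<close>.
\<close>

lemma minimal_conj_unique:
  assumes "a \<in> S" "b \<in> S" "reflection r" "reflection q"
    and "a \<notin> N r" "b \<notin> N r" "a \<notin> N q" "b \<notin> N q"
    and "z \<in> generate G {a, b}" "conj_by z r = q"
  shows "q = r"
  using assms(9,10)
proof (induction "len z" arbitrary: z rule: less_induct)
  case less
  have r: "r \<in> carrier G" and q: "q \<in> carrier G" using assms reflection_in by auto
  have ab: "{a, b} \<subseteq> S" using assms by auto
  have z: "z \<in> carrier G" using less generate_in ab by blast
  show ?case
  proof (cases "z = \<one>")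
    case True
    then show ?thesis using less r by simp
  next
    case False
    then obtain x where x: "x \<in> {a, b}" "x \<in> N z" "conj_by q x \<in> {a, b}"
      using minimal_conj_commutes[OF ab assms(3,4) _ _ less(2) _ less(3)] assms by blast
    then have xS: "x \<in> S" "x \<in> carrier G" "x \<in> generate G {a, b}" using ab by (auto intro: generate.incl)
    have "conj_by q x = x"
      using no_swap[OF assms(4), of a b] no_swap[OF assms(4), of b a] x assms by auto
    then have qx: "conj_by x q = q" using conj_by_commute_sym xS q by auto
    have "len (x \<otimes> z) < len z" using x N_len_less z by blast
    moreover have "x \<otimes> z \<in> generate G {a, b}" using xS less by (auto intro: generate.eng)
    moreover have "conj_by (x \<otimes> z) r = q" using less(3) qx xS z r by (simp add: conj_by_mult)
    ultimately show ?thesis using less(1) by blast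
  qed
qed

text \<open>
  Among the conjugates of \<open>r\<close> under the dihedral group of \<open>a\<close> and
  \<open>b\<close>, one of least length has neither \<open>a\<close> nor \<open>b\<close> as a
  descent, and by \<open>minimal_conj_unique\<close> it is \<open>r\<close>.
\<close>

lemma residue_len:
  assumes "a \<in> S" "b \<in> S" "reflection r" "a \<notin> N r" "b \<notin> N r" "z \<in> generate G {a, b}"
    and "conj_by z r \<noteq> r"
  shows "len r < len (conj_by z r)"
proof -
  let ?D = "generate G {a, b}"
  have ab: "{a, b} \<subseteq> S" using assms by auto
  note sub = generate_subgroup[OF ab] and D_in = generate_in[OF ab]
  have r: "r \<in> carrier G" using assms reflection_in by auto
  have *: "conj_by y r = r" if y: "y \<in> ?D" "\<And>v. v \<in> ?D \<Longrightarrow> len (conj_by y r) \<le> len (conj_by v r)" for y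
  proof -
    let ?q = "conj_by y r"
    have q: "reflection ?q" "?q \<in> carrier G" using assms y D_in reflection_conj reflection_in by auto
    have "c \<notin> N ?q" if c: "c \<in> {a, b}" for c
    proof
      assume cN: "c \<in> N ?q"
      have cS: "c \<in> S" "c \<in> carrier G" "c \<in> ?D" using c ab by (auto intro: generate.incl)
      show False
      proof (cases "conj_by c ?q = ?q")
        case True
        then have "conj_by ?q c = c" using conj_by_commute_sym cS q by auto
        then have "c = ?q" using commuting_descent[OF q(1), of c] cS cN by auto
        then have "r = conj_by (inv y) c" using y D_in r by simp
        moreover have "inv y \<in> ?D" using y sub by (simp add: subgroup.m_inv_closed)
        ultimately have "r \<in> ?D" using generate_conj ab cS by auto
        moreover have "N r \<inter> ?D = {}" using N_disjoint_generate[OF ab r] assms by auto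
        ultimately show False using reflection_in_N_self assms by auto
      next
        case False
        then have "len (conj_by c ?q) < len ?q" using len_conj_gen(1)[OF q(1)] cS cN by auto
        moreover have "conj_by c ?q = conj_by (c \<otimes> y) r" using cS y D_in r by (simp add: conj_by_mult)
        moreover have "c \<otimes> y \<in> ?D" using cS y by (auto intro: generate.eng)
        ultimately show False using y(2)[of "c \<otimes> y"] by auto
      qed
    qed
    then show ?thesis using minimal_conj_unique[OF assms(1-3) q(1)] assms y by auto
  qed
  obtain y where y: "y \<in> ?D" "\<And>v. v \<in> ?D \<Longrightarrow> len (conj_by y r) \<le> len (conj_by v r)"
    using ex_has_least_nat[of "\<lambda>u. u \<in> ?D" \<one> "\<lambda>u. len (conj_by u r)"] by (auto intro: generate.one)
  then have "len r \<le> len (conj_by v r)" if "v \<in> ?D" for v using *[OF y] that by auto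
  then show ?thesis using *[of z] assms by (metis le_neq_implies_less)
qed

text \<open>
  Together with \<open>residue_len\<close> this describes the lowest points of a rank two
  residue: a single one, or two that are adjacent across a generator commuting with
  \<open>r\<close>.
\<close>

lemma centralising_in_residue:
  assumes "a \<in> S" "b \<in> S" "reflection r" "a \<notin> N r" "b \<notin> N r" "u \<in> generate G {a, b}"
    and "conj_by u r = r" "conj_by a r \<noteq> r"
  shows "u = \<one> \<or> u = b \<and> conj_by b r = r"
proof (rule ccontr)
  assume neg: "\<not> ?thesis"
  have ab: "{a, b} \<subseteq> S" using assms by auto
  have r: "r \<in> carrier G" using assms reflection_in by auto
  have desc: "b \<in> N v \<and> conj_by b r = r" if v: "v \<in> generate G {a, b}" "v \<noteq> \<one>" "conj_by v r = r" for v
  proof -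
    obtain x where x: "x \<in> {a, b}" "x \<in> N v" "conj_by r x \<in> {a, b}"
      using minimal_conj_commutes[OF ab assms(3,3) _ _ v] assms by blast
    then have "conj_by r x = x" using no_swap[OF assms(3), of a b] no_swap[OF assms(3), of b a] assms by auto
    then have "conj_by x r = r" using conj_by_commute_sym[of x r] r x ab by auto
    then show ?thesis using x assms(8) by auto
  qed
  have u: "u \<in> carrier G" using assms generate_in ab by blast
  have bu: "b \<in> N u" "conj_by b r = r" using desc[OF assms(6) _ assms(7)] neg by auto
  have "b \<otimes> u \<in> generate G {a, b}" using assms by (auto intro: generate.eng generate.incl)
  moreover have "b \<otimes> u \<noteq> \<one>"
  proof
    assume *: "b \<otimes> u = \<one>"
    have "u = b \<otimes> (b \<otimes> u)" using assms u by simp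
    then show False using neg * bu assms by simp
  qed
  moreover have "conj_by (b \<otimes> u) r = r" using assms u r bu by (simp add: conj_by_mult)
  ultimately have "b \<in> N (b \<otimes> u)" using desc by blast
  then show False using N_gen_mult[of b u b] bu assms u by (simp add: conj_by_self)
qed

section \<open>Going round a finite dihedral residue\<close>

definition step_in :: "('a \<Rightarrow> bool) \<Rightarrow> 'a \<Rightarrow> 'a \<Rightarrow> bool" where
  "step_in P x y \<longleftrightarrow> P x \<and> P y \<and> (\<exists>c\<in>S. y = x \<otimes> c)"

text \<open>
  The product of the first \<open>j\<close> letters of \<open>a b a b \<dots>\<close>; these
  products run through the residue in cyclic order.
\<close>

definition alternating :: "'a \<Rightarrow> 'a \<Rightarrow> nat \<Rightarrow> 'a" where
  "alternating a b j = (a \<otimes> b) [^] (j div 2) \<otimes> (if even j then \<one> else a)"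

lemma alternating_closed [simp]: "a \<in> S \<Longrightarrow> b \<in> S \<Longrightarrow> alternating a b j \<in> carrier G"
  by (simp add: alternating_def)

lemma alternating_Suc:
  assumes "a \<in> S" "b \<in> S"
  shows "alternating a b (Suc j) = alternating a b j \<otimes> (if even j then a else b)"
proof (cases "even j")
  case True
  then show ?thesis using assms by (auto simp: alternating_def elim!: evenE)
next
  case False
  then obtain k where "j = 2 * k + 1" by (auto elim: oddE)
  then show ?thesis using assms by (simp add: alternating_def m_assoc)
qed

lemma alternating_in_generate:
  assumes "a \<in> S" "b \<in> S" shows "alternating a b j \<in> generate G {a, b}"
proof (induction j)
  case 0
  then show ?case by (auto simp: alternating_def generate.one)
next
  case (Suc j)
  then show ?case using assms by (auto simp: alternating_Suc intro!: generate.eng[OF _ generate.incl])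
qed

lemma pow_Suc_shift:
  assumes "a \<in> S" "b \<in> S" shows "(a \<otimes> b) [^] Suc k = a \<otimes> (b \<otimes> a) [^] k \<otimes> b"
proof (induction k)
  case 0
  then show ?case using assms by simp
next
  case (Suc k)
  have "(a \<otimes> b) [^] Suc (Suc k) = (a \<otimes> (b \<otimes> a) [^] k \<otimes> b) \<otimes> (a \<otimes> b)" using Suc by simp
  then show ?case using assms by (simp add: m_assoc)
qed

text \<open>
  A word of odd length in alternating letters is a palindrome, so its value is conjugate to its
  middle letter.
\<close>

lemma odd_alternating_not_one:
  assumes "a \<in> S" "b \<in> S" shows "(a \<otimes> b) [^] (k::nat) \<otimes> a \<noteq> \<one>"
  using assms
proof (induction k arbitrary: a b)
  case 0
  then show ?case by simp
next
  case (Suc k)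
  let ?x = "(b \<otimes> a) [^] k \<otimes> b"
  have "(a \<otimes> b) [^] Suc k \<otimes> a = conj_by a ?x"
    using Suc.prems pow_Suc_shift by (simp add: conj_by_def m_assoc)
  moreover have "conj_by a ?x \<noteq> \<one>"
  proof
    assume "conj_by a ?x = \<one>"
    then have "?x = conj_by (inv a) \<one>" using conj_by_eq_iff[of a ?x \<one>] Suc.prems by simp
    then show False using Suc by (simp add: conj_by_def S_square)
  qed
  ultimately show ?case by simp
qed

lemma dihedral_order:
  assumes "a \<in> S" "b \<in> S" "finite (generate G {a, b})"
  obtains n where "n > 0" "alternating a b (2 * n) = \<one>"
    "\<And>j. 0 < j \<Longrightarrow> j < 2 * n \<Longrightarrow> alternating a b j \<noteq> \<one>"
proof -
  have "\<not> inj (\<lambda>k::nat. alternating a b (2 * k))"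
    using assms alternating_in_generate finite_subset[of "range (\<lambda>k. alternating a b (2 * k))" "generate G {a, b}"]
    by (metis finite_imageD image_subsetI infinite_UNIV_nat)
  then obtain i k where "i < k" "alternating a b (2 * i) = alternating a b (2 * k)"
    unfolding inj_def by (metis linorder_neqE_nat)
  then have ik: "i < k" "(a \<otimes> b) [^] i = (a \<otimes> b) [^] k" using assms by (auto simp: alternating_def)
  have "(a \<otimes> b) [^] i \<otimes> (a \<otimes> b) [^] (k - i) = (a \<otimes> b) [^] i \<otimes> \<one>"
    using ik assms nat_pow_mult[of "a \<otimes> b" i "k - i"] by simp
  then have ex: "0 < k - i \<and> (a \<otimes> b) [^] (k - i) = \<one>" using ik assms by (simp del: r_one)
  define n where "n = (LEAST n. 0 < n \<and> (a \<otimes> b) [^] (n::nat) = \<one>)"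
  have n: "0 < n \<and> (a \<otimes> b) [^] n = \<one>" unfolding n_def by (rule LeastI, rule ex)
  have min: "(a \<otimes> b) [^] m \<noteq> \<one>" if "0 < m" "m < n" for m
    using that not_less_Least unfolding n_def by blast
  show thesis
  proof (rule that[of n])
    show "n > 0" "alternating a b (2 * n) = \<one>" using n by (auto simp: alternating_def)
    show "alternating a b j \<noteq> \<one>" if "0 < j" "j < 2 * n" for j
    proof (cases "even j")
      case True
      then show ?thesis using that min[of "j div 2"] assms by (auto simp: alternating_def elim!: evenE)
    next
      case False
      then show ?thesis using odd_alternating_not_one assms by (simp add: alternating_def)
    qed
  qed
qed

lemma alternating_path:
  assumes "a \<in> S" "b \<in> S" "\<And>j. j \<le> m \<Longrightarrow> P (alternating a b (Suc j))"
  shows "(step_in P)\<^sup>*\<^sup>* a (alternating a b (Suc m))"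
  using assms(3)
proof (induction m)
  case 0
  then show ?case using assms by (simp add: alternating_def)
next
  case (Suc m)
  have "step_in P (alternating a b (Suc m)) (alternating a b (Suc (Suc m)))"
    using Suc(2)[of m] Suc(2)[of "Suc m"] assms alternating_Suc[of a b "Suc m"] by (auto simp: step_in_def)
  then show ?case using Suc by (meson le_SucI rtranclp.rtrancl_into_rtrancl)
qed

text \<open>
  In the cycle formed by a finite dihedral group, \<open>a\<close> and \<open>b\<close> are the
  two neighbours of \<open>1\<close>; the way from \<open>a\<close> to \<open>b\<close> round
  the cycle avoids \<open>1\<close>.
\<close>

lemma dihedral_path:
  assumes "a \<in> S" "b \<in> S" "finite (generate G {a, b})"
    and P: "\<And>u. u \<in> generate G {a, b} \<Longrightarrow> u \<noteq> \<one> \<Longrightarrow> P u"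
  shows "(step_in P)\<^sup>*\<^sup>* a b"
proof -
  obtain n where n: "n > 0" "alternating a b (2 * n) = \<one>"
    "\<And>j. 0 < j \<Longrightarrow> j < 2 * n \<Longrightarrow> alternating a b j \<noteq> \<one>"
    using dihedral_order[OF assms(1-3)] by metis
  have "alternating a b (2 * n - 1) \<otimes> b = \<one>"
    using alternating_Suc[OF assms(1,2), of "2 * n - 1"] n by simp
  then have "alternating a b (2 * n - 1) = b"
    using assms S_cancel_right[of b "alternating a b (2 * n - 1)"] by simp
  moreover have "(step_in P)\<^sup>*\<^sup>* a (alternating a b (Suc (2 * n - 2)))"
    using n P assms alternating_in_generate by (intro alternating_path) auto
  moreover have "Suc (2 * n - 2) = 2 * n - 1" using n by simp
  ultimately show ?thesis by simp
qed

text \<open>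
  The same walk stopped at the last element before \<open>b\<close>, so that it avoids the edge
  from \<open>1\<close> to \<open>b\<close> altogether.
\<close>

lemma dihedral_path_avoiding:
  assumes "a \<in> S" "b \<in> S" "a \<noteq> b" "finite (generate G {a, b})"
    and P: "\<And>u. u \<in> generate G {a, b} \<Longrightarrow> u \<noteq> \<one> \<Longrightarrow> u \<noteq> b \<Longrightarrow> P u"
  shows "(step_in P)\<^sup>*\<^sup>* a (b \<otimes> a)"
proof -
  obtain n where n: "n > 0" "alternating a b (2 * n) = \<one>"
    "\<And>j. 0 < j \<Longrightarrow> j < 2 * n \<Longrightarrow> alternating a b j \<noteq> \<one>"
    using dihedral_order[OF assms(1,2,4)] by metis
  have ab: "alternating a b 2 = a \<otimes> b" using assms by (simp add: alternating_def)
  have "n \<noteq> 1"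
  proof
    assume "n = 1"
    then have "a \<otimes> b = \<one>" using n ab by simp
    then show False using assms S_cancel_right[of b a] by simp
  qed
  then have n2: "n \<ge> 2" using n by auto
  have "alternating a b (2 * n - 2) \<otimes> (a \<otimes> b) = \<one>"
  proof -
    have "alternating a b (2 * (n - 1)) \<otimes> (a \<otimes> b) = (a \<otimes> b) [^] Suc (n - 1)"
      using assms by (simp add: alternating_def)
    then show ?thesis using n assms by (simp add: alternating_def right_diff_distrib')
  qed
  then have "alternating a b (2 * n - 2) = inv (a \<otimes> b)" using assms by (simp add: inv_equality)
  also have "\<dots> = b \<otimes> a" using assms by (simp add: inv_mult_group)
  finally have last: "alternating a b (2 * n - 2) = b \<otimes> a" .
  have "P (alternating a b j)" if j: "1 \<le> j" "j \<le> 2 * n - 2" for j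
  proof (rule P)
    show "alternating a b j \<in> generate G {a, b}" using alternating_in_generate assms by blast
    show "alternating a b j \<noteq> \<one>" using n j by auto
    show "alternating a b j \<noteq> b"
    proof
      assume *: "alternating a b j = b"
      show False
      proof (cases "even j")
        case True
        then obtain i where i: "j = Suc i" "odd i" using j by (cases j) auto
        then have "alternating a b i \<otimes> b = b" using * alternating_Suc assms by simp
        then have "alternating a b i = \<one>" using assms S_cancel_right[of b "alternating a b i"] by (simp add: S_square)
        then show False using n i j by (cases i) auto
      next
        case False
        then have "alternating a b (Suc j) = \<one>" using * alternating_Suc assms by (simp add: S_square)
        moreover have "Suc j < 2 * n" using j n2 by linarith
        ultimately show False using n(3)[of "Suc j"] by simp
      qed
    qed
  qed
  then have "(step_in P)\<^sup>*\<^sup>* a (alternating a b (Suc (2 * n - 3)))"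
    using n2 assms by (intro alternating_path) auto
  moreover have "Suc (2 * n - 3) = 2 * n - 2" using n2 by simp
  ultimately show ?thesis using last by simp
qed

section \<open>Depth with respect to a wall\<close>

text \<open>
  This is the distance from \<open>x\<close> to its mirror image \<open>s x\<close> in the
  Cayley graph of \<open>S\<close>.
\<close>

definition depth :: "'a \<Rightarrow> 'a \<Rightarrow> nat" where
  "depth s x = len (conj_by (inv x) s)"

definition deep_edge :: "'a \<Rightarrow> nat \<Rightarrow> 'a \<Rightarrow> 'a \<Rightarrow> bool" where
  "deep_edge s n x y \<longleftrightarrow> x \<in> carrier G \<and> y \<in> carrier G \<and> s \<notin> N x \<and> s \<notin> N y \<and>
     n \<le> depth s x \<and> n \<le> depth s y \<and> (\<exists>c\<in>S. y = x \<otimes> c)"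

lemma deep_edge_sym: "deep_edge s n x y \<Longrightarrow> deep_edge s n y x"
  unfolding deep_edge_def by (metis S_cancel_right)

lemma deep_path_sym: "(deep_edge s n)\<^sup>*\<^sup>* x y \<Longrightarrow> (deep_edge s n)\<^sup>*\<^sup>* y x"
  by (induction rule: rtranclp_induct) (auto intro: deep_edge_sym converse_rtranclp_into_rtranclp)

lemma depth_mult:
  assumes "s \<in> S" "x \<in> carrier G" "y \<in> carrier G"
  shows "depth s (x \<otimes> y) = len (conj_by (inv y) (conj_by (inv x) s))"
  using assms by (simp add: depth_def inv_mult_group conj_by_mult)

lemma side_mult_gen:
  assumes "s \<in> S" "x \<in> carrier G" "c \<in> S"
  shows "s \<in> N (x \<otimes> c) \<longleftrightarrow> (s \<in> N x) \<noteq> (c = conj_by (inv x) s)"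
  using assms by (auto simp: N_mult N_gen)

lemma reflection_len_pos: "reflection r \<Longrightarrow> 0 < len r"
  using reflection_palindrome by fastforce

text \<open>
  Left multiplication by \<open>w\<close> carries a walk in the dihedral group to a gallery in
  the residue of \<open>w\<close>. Where the conjugate of \<open>r\<close> differs from
  \<open>r\<close>, the depth exceeds that of \<open>w\<close>; in particular it exceeds
  \<open>1\<close>, so no step crosses the wall of \<open>s\<close>.
\<close>

lemma residue_path:
  fixes r
  assumes "s \<in> S" "w \<in> carrier G" "a \<in> S" "b \<in> S"
    and "r = conj_by (inv w) s" "a \<notin> N r" "b \<notin> N r"
    and "(step_in (\<lambda>u. u \<in> generate G {a, b} \<and> conj_by u r \<noteq> r))\<^sup>*\<^sup>* u v" "u \<in> carrier G" "s \<notin> N (w \<otimes> u)"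
  shows "(deep_edge s (Suc (len r)))\<^sup>*\<^sup>* (w \<otimes> u) (w \<otimes> v) \<and> s \<notin> N (w \<otimes> v)"
  using assms(8)
proof (induction rule: rtranclp_induct)
  case base
  then show ?case using assms by simp
next
  case (step y z)
  have ab: "{a, b} \<subseteq> S" using assms by auto
  have r: "reflection r" "r \<in> carrier G" using assms reflection_conj reflection_gen by auto
  have y: "y \<in> generate G {a, b}" "conj_by y r \<noteq> r" and z: "z \<in> generate G {a, b}" "conj_by z r \<noteq> r"
    using step(2) by (auto simp: step_in_def)
  have deep: "len r < depth s (w \<otimes> x) \<and> x \<in> carrier G" if x: "x \<in> generate G {a, b}" "conj_by x r \<noteq> r" for x
  proof -
    have xc: "x \<in> carrier G" using x generate_in ab by blast
    have "inv x \<in> generate G {a, b}" using x generate_subgroup[OF ab] by (simp add: subgroup.m_inv_closed)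
    moreover have "conj_by (inv x) r \<noteq> r" using x xc r conj_by_inv_cancel(1)[of x r] by metis
    ultimately have "len r < len (conj_by (inv x) r)" using residue_len assms r by blast
    then show ?thesis using depth_mult assms xc by simp
  qed
  obtain c where c: "c \<in> S" "z = y \<otimes> c" using step(2) by (auto simp: step_in_def)
  have eq: "w \<otimes> z = w \<otimes> y \<otimes> c" using c deep[OF y] assms by (simp add: m_assoc)
  have "len c < depth s (w \<otimes> y)" using deep[OF y] reflection_len_pos[OF r(1)] len_gen[OF c(1)] by simp
  then have "c \<noteq> conj_by (inv (w \<otimes> y)) s" by (auto simp: depth_def)
  then have "s \<notin> N (w \<otimes> z)" using eq side_mult_gen[of s "w \<otimes> y" c] c step deep[OF y] assms by simp
  moreover from this have "deep_edge s (Suc (len r)) (w \<otimes> y) (w \<otimes> z)"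
    unfolding deep_edge_def using step deep[OF y] deep[OF z] c eq assms by (auto simp: Suc_le_eq)
  ultimately show ?case using step by auto
qed

lemma ascending_not_descent:
  assumes "reflection r" "c \<in> S" "len r < len (conj_by c r)"
  shows "c \<notin> N r" "conj_by c r \<noteq> r"
proof -
  show "conj_by c r \<noteq> r" using assms(3) by auto
  then show "c \<notin> N r" using len_conj_gen(1)[OF assms(1,2)] assms(3) by (metis less_asym)
qed

text \<open>
  The gallery is followed from its start, and a companion gallery of depth greater than
  \<open>n\<close> is built. While the gallery runs on the level \<open>n\<close>, the companion
  runs above it at a neighbour \<open>y d\<close> of the current element \<open>y\<close>. If
  the next step along \<open>c\<close> rises, the companion passes from \<open>y d\<close> to
  \<open>y c\<close> round the residue. If it stays on the level, then \<open>c\<close> commutes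
  with the reflection \<open>r\<close> seen from \<open>y\<close>, the same \<open>r\<close> is
  seen from \<open>y c\<close>, and the companion passes from \<open>y d\<close> to \<open>y c
  d\<close>.
\<close>

lemma push_path_deeper:
  assumes fin: "\<And>a b. a \<in> S \<Longrightarrow> b \<in> S \<Longrightarrow> finite (generate G {a, b})"
    and s: "s \<in> S" and path: "(deep_edge s n)\<^sup>*\<^sup>* x y"
    and x: "n < depth s x" and y: "n < depth s y"
  shows "(deep_edge s (Suc n))\<^sup>*\<^sup>* x y"
proof -
  let ?E = "deep_edge s (Suc n)"
  define up where "up z c \<longleftrightarrow> c \<in> S \<and> s \<notin> N (z \<otimes> c) \<and> n < depth s (z \<otimes> c)" for z c
  have "(n < depth s y \<longrightarrow> ?E\<^sup>*\<^sup>* x y) \<and>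
        (depth s y = n \<longrightarrow> (\<exists>c. up y c \<and> ?E\<^sup>*\<^sup>* x (y \<otimes> c)))"
    using path
  proof (induction rule: rtranclp_induct)
    case base
    then show ?case using x by simp
  next
    case (step y z)
    obtain c where c: "c \<in> S" "z = y \<otimes> c" and y: "y \<in> carrier G" "s \<notin> N y" "n \<le> depth s y"
      and z: "z \<in> carrier G" "s \<notin> N z" "n \<le> depth s z"
      using step(2) by (auto simp: deep_edge_def)
    have yz: "y = z \<otimes> c" using c y by simp
    define r where "r = conj_by (inv y) s"
    have r: "reflection r" "r \<in> carrier G" "len r = depth s y"
      using s y reflection_conj reflection_gen by (auto simp: r_def depth_def)
    have dep: "depth s (y \<otimes> d) = len (conj_by d r)" if "d \<in> S" for d
      using depth_mult[of s y d] that s y by (simp add: r_def)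
    show ?case
    proof (cases "n < depth s y")
      case high: True
      then have xy: "?E\<^sup>*\<^sup>* x y" using step by simp
      show ?thesis
      proof (intro conjI impI)
        assume "n < depth s z"
        then have "?E y z" using high step(2) by (auto simp: deep_edge_def)
        then show "?E\<^sup>*\<^sup>* x z" using xy by simp
      next
        have "up z c" using yz high y c by (simp add: up_def)
        then show "\<exists>c. up z c \<and> ?E\<^sup>*\<^sup>* x (z \<otimes> c)" using yz xy by auto
      qed
    next
      case False
      then have low: "len r = n" using r y by simp
      then obtain d where d: "up y d" "?E\<^sup>*\<^sup>* x (y \<otimes> d)" using step r by auto
      then have dS: "d \<in> S" by (simp add: up_def)
      have dup: "len r < len (conj_by d r)" using d dep low by (auto simp: up_def)
      note dr = ascending_not_descent[OF r(1) dS dup]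
      show ?thesis
      proof (intro conjI impI)
        assume "n < depth s z"
        then have cup: "len r < len (conj_by c r)" using dep c low by simp
        note cr = ascending_not_descent[OF r(1) c(1) cup]
        have "(step_in (\<lambda>u. u \<in> generate G {d, c} \<and> conj_by u r \<noteq> r))\<^sup>*\<^sup>* d c"
          using centralising_in_residue[OF dS c(1) r(1)] dr cr
          by (intro dihedral_path fin dS c) auto
        then have "?E\<^sup>*\<^sup>* (y \<otimes> d) z"
          using residue_path[OF s y(1) dS c(1) r_def dr(1) cr(1), of d c] d dS low c by (simp add: up_def)
        then show "?E\<^sup>*\<^sup>* x z" using d by simp
      next
        assume "depth s z = n"
        then have "len (conj_by c r) = len r" using dep c low by simp
        then have flat: "conj_by c r = r" using len_conj_gen[OF r(1) c(1)] by (metis less_irrefl)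
        have "c \<noteq> r" using side_mult_gen[of s y c] s y z c by (auto simp: r_def)
        then have cr: "c \<notin> N r"
          using commuting_descent[OF r(1), of c] flat conj_by_commute_sym[of c r] c r by auto
        have "d \<noteq> c" using flat dup by auto
        then have "(step_in (\<lambda>u. u \<in> generate G {d, c} \<and> conj_by u r \<noteq> r))\<^sup>*\<^sup>* d (c \<otimes> d)"
          using centralising_in_residue[OF dS c(1) r(1)] dr cr
          by (intro dihedral_path_avoiding fin dS c) auto
        then have "?E\<^sup>*\<^sup>* (y \<otimes> d) (y \<otimes> (c \<otimes> d)) \<and> s \<notin> N (y \<otimes> (c \<otimes> d))"
          using residue_path[OF s y(1) dS c(1) r_def dr(1) cr, of d "c \<otimes> d"] d dS low by (simp add: up_def)
        then have zd: "?E\<^sup>*\<^sup>* (y \<otimes> d) (z \<otimes> d)" "s \<notin> N (z \<otimes> d)"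
          using c y dS by (simp_all add: m_assoc)
        have "depth s (z \<otimes> d) = len (conj_by d (conj_by c r))"
          using depth_mult[of s y "c \<otimes> d"] s y c dS by (simp add: r_def m_assoc inv_mult_group conj_by_mult)
        then have "up z d" using zd dup flat low dS by (simp add: up_def)
        then show "\<exists>c. up z c \<and> ?E\<^sup>*\<^sup>* x (z \<otimes> c)" using zd d by (meson rtranclp_trans)
      qed
    qed
  qed
  then show ?thesis using y by simp
qed

text \<open>
  A reduced word of \<open>x\<close>, read backwards, leads to \<open>1\<close> without crossing
  walls that do not separate \<open>x\<close> from \<open>1\<close>.
\<close>

lemma half_space_connected:
  assumes "s \<in> S" "x \<in> carrier G" "s \<notin> N x"
  shows "(deep_edge s 0)\<^sup>*\<^sup>* x \<one>"
  using assms(2,3)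
proof (induction "len x" arbitrary: x rule: less_induct)
  case less
  show ?case
  proof (cases "x = \<one>")
    case False
    then have "inv x \<noteq> \<one>" using less by simp
    then obtain c where c: "c \<in> S" "c \<in> N (inv x)"
      using ex_descent[of S "inv x"] S_generate less by auto
    then have "len (x \<otimes> c) < len x" using len_less_right[of c x] reflection_gen less by auto
    moreover have "s \<notin> N (x \<otimes> c)"
    proof
      assume "s \<in> N (x \<otimes> c)"
      then have "c = conj_by (inv x) s" using side_mult_gen assms less c by auto
      then show False using c N_inv[of x c] less assms by simp
    qed
    moreover from this have "deep_edge s 0 x (x \<otimes> c)" using less c by (auto simp: deep_edge_def)
    ultimately show ?thesis using less c by (meson S_in converse_rtranclp_into_rtranclp m_closed)
  qed auto
qed

theorem deep_part_connected:
  assumes "\<And>a b. a \<in> S \<Longrightarrow> b \<in> S \<Longrightarrow> finite (generate G {a, b})" "s \<in> S"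
    and "x \<in> carrier G" "y \<in> carrier G" "s \<notin> N x" "s \<notin> N y" "n \<le> depth s x" "n \<le> depth s y"
  shows "(deep_edge s n)\<^sup>*\<^sup>* x y"
  using assms(7,8)
proof (induction n)
  case 0
  have "(deep_edge s 0)\<^sup>*\<^sup>* x \<one>" "(deep_edge s 0)\<^sup>*\<^sup>* \<one> y"
    using half_space_connected deep_path_sym assms by auto
  then show ?case by auto
next
  case (Suc n)
  then show ?case using push_path_deeper[OF assms(1,2)] by simp
qed

section \<open>Conjugacy classes of generators\<close>

text \<open>
  A shortest gallery from \<open>x\<close> to \<open>y\<close> crosses the wall of
  \<open>t\<close>, and it stays on the common side of every wall that does not separate
  \<open>x\<close> from \<open>y\<close>.
\<close>

lemma crossing_edge:
  assumes "x \<in> carrier G" "y \<in> carrier G" "t \<in> carrier G" "(t \<in> N x) \<noteq> (t \<in> N y)"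
  shows "\<exists>z\<in>carrier G. \<exists>c\<in>S. conj_by z c = t \<and>
    (\<forall>p\<in>carrier G. (p \<in> N x) = (p \<in> N y) \<longrightarrow> (p \<in> N z) = (p \<in> N x) \<and> (p \<in> N (z \<otimes> c)) = (p \<in> N x))"
  using assms(1,4)
proof (induction "len (inv x \<otimes> y)" arbitrary: x rule: less_induct)
  case less
  have x: "x \<in> carrier G" and y: "y \<in> carrier G" using less assms by auto
  have yx: "y = x \<otimes> (inv x \<otimes> y)" using x y by simp
  have "inv x \<otimes> y \<noteq> \<one>" using yx less x by auto
  then obtain c where c: "c \<in> S" "c \<in> N (inv x \<otimes> y)"
    using ex_descent[of S "inv x \<otimes> y"] S_generate x y by auto
  define w where "w = conj_by x c"
  have w: "w \<in> carrier G" using c x by (simp add: w_def)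
  have Nx': "p \<in> N (x \<otimes> c) \<longleftrightarrow> (p \<in> N x) \<noteq> (p = w)" if "p \<in> carrier G" for p
    using N_mult_gen that c x by (simp add: w_def)
  have "w \<in> N (x \<otimes> (inv x \<otimes> y)) \<longleftrightarrow> w \<notin> N x"
    using N_mult[of x "inv x \<otimes> y" w] c x y by (simp add: w_def)
  then have wdiff: "(w \<in> N x) \<noteq> (w \<in> N y)" using yx by simp
  show ?case
  proof (cases "t = w")
    case True
    then show ?thesis using wdiff Nx' x c w_def by (intro bexI[of _ x] bexI[of _ c]) auto
  next
    case False
    have "len (c \<otimes> (inv x \<otimes> y)) < len (inv x \<otimes> y)" using N_len_less c x y by blast
    moreover have "c \<otimes> (inv x \<otimes> y) = inv (x \<otimes> c) \<otimes> y" using c x y by (simp add: inv_mult_group m_assoc)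
    moreover have "(t \<in> N (x \<otimes> c)) \<noteq> (t \<in> N y)" using False Nx' less assms by simp
    ultimately obtain z d where zd: "z \<in> carrier G" "d \<in> S" "conj_by z d = t"
      "\<forall>p\<in>carrier G. (p \<in> N (x \<otimes> c)) = (p \<in> N y) \<longrightarrow>
         (p \<in> N z) = (p \<in> N (x \<otimes> c)) \<and> (p \<in> N (z \<otimes> d)) = (p \<in> N (x \<otimes> c))"
      using less(1)[of "x \<otimes> c"] x c by auto
    have "(p \<in> N z) = (p \<in> N x) \<and> (p \<in> N (z \<otimes> d)) = (p \<in> N x)"
      if p: "p \<in> carrier G" "(p \<in> N x) = (p \<in> N y)" for p
      using zd(4) p Nx'[OF p(1)] wdiff by metis
    then show ?thesis using zd by blast
  qed
qed

text \<open>
  Let \<open>k' = b k b\<close> and \<open>b' = u b u\<inverse>\<close>. Under the hypotheses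
  \<open>u\<close> preserves the half-spaces of \<open>k\<close> and of \<open>k'\<close>, so
  \<open>b'\<close>, like \<open>b\<close>, exchanges the positive half-space of
  \<open>k\<close> with that of \<open>k'\<close>. Hence \<open>b'\<close> exchanges the convex
  regions \<open>Y\<close>, positive for \<open>k\<close> and negative for \<open>k'\<close>,
  and \<open>Y'\<close>, negative for \<open>k\<close> and positive for \<open>k'\<close>. No
  edge crossing the wall of \<open>b'\<close> lies in \<open>Y\<close>, so \<open>Y\<close> lies
  on one side of this wall and \<open>Y'\<close> on the other. Now \<open>b k \<in> Y\<close>
  and \<open>k \<in> Y'\<close>, and a gallery from \<open>b k\<close> through \<open>b\<close>
  and \<open>1\<close> to \<open>k\<close> crosses the walls of \<open>k'\<close>,
  \<open>b\<close> and \<open>k\<close> only; so \<open>b' = b\<close>.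
\<close>

lemma fixes_neighbour:
  assumes "k \<in> S" "b \<in> S" "conj_by b k \<noteq> k" "u \<in> carrier G"
    and "conj_by u k = k" "conj_by u (conj_by b k) = conj_by b k"
    and "k \<notin> N u" "conj_by b k \<notin> N u"
  shows "conj_by u b = b"
proof -
  define k' where "k' = conj_by b k"
  define b' where "b' = conj_by u b"
  have k: "k \<in> carrier G" and k': "k' \<in> carrier G" "k' \<noteq> k" and b: "b \<in> carrier G"
    using assms by (auto simp: k'_def)
  have b': "reflection b'" "b' \<in> carrier G" using assms reflection_conj reflection_gen by (auto simp: b'_def)
  have bk': "conj_by b k' = k" using conj_by_inv_cancel(1)[of b k] assms by (simp add: k'_def)
  have uk: "conj_by (inv u) k = k" "conj_by (inv u) k' = k'"
    using conj_by_inv_cancel(2)[of u k] conj_by_inv_cancel(2)[of u k'] assms k k' by (auto simp: k'_def)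
  have b'k: "conj_by b' k = k'" "conj_by b' k' = k"
    unfolding b'_def using uk bk' assms k k' by (simp_all add: conj_by_conj_by k'_def)
  have neq: "b' \<noteq> k" "b' \<noteq> k'" using b'k k' k b' conj_by_self by auto
  \<comment> \<open>Hence multiplication by \<open>b'\<close> maps the sides of \<open>k\<close> to those of
    \<open>k'\<close> and conversely, without changing signs.\<close>
  have nb': "k \<notin> N b'" "k' \<notin> N b'"
    using N_conj[of u b k] N_conj[of u b k'] assms k k' b'k neq by (auto simp: b'_def k'_def)
  have flip: "k \<in> N (b' \<otimes> x) \<longleftrightarrow> k' \<in> N x" "k' \<in> N (b' \<otimes> x) \<longleftrightarrow> k \<in> N x" "b' \<in> N (b' \<otimes> x) \<longleftrightarrow> b' \<notin> N x"
    if "x \<in> carrier G" for x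
    using that b' k k' b'k nb' reflection_in_N_self[OF b'(1)] by (simp_all add: N_mult conj_by_self)
  have bkneq: "k \<noteq> b" using assms conj_by_self by auto
  have bk'neq: "k' \<noteq> b" using bk' conj_by_self[of b] bkneq b by auto
  have bk: "k \<notin> N (b \<otimes> k)" "k' \<in> N (b \<otimes> k)"
    using N_gen_mult[of b k] assms k k' bk' bkneq bk'neq N_gen[of k] by (auto simp: k'_def)
  have b'bk: "k \<notin> N (b' \<otimes> k)" "k' \<in> N (b' \<otimes> k)"
    using flip[of k] N_gen[of k] assms k k' by auto
  have "b' \<in> N (b \<otimes> k) \<longleftrightarrow> b' \<in> N (b' \<otimes> k)"
  proof (rule ccontr)
    assume "\<not> ?thesis"
    then obtain z c where zc: "z \<in> carrier G" "c \<in> S" "conj_by z c = b'"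
      and same: "\<And>p. p \<in> carrier G \<Longrightarrow> (p \<in> N (b \<otimes> k)) = (p \<in> N (b' \<otimes> k)) \<Longrightarrow>
        (p \<in> N z) = (p \<in> N (b \<otimes> k)) \<and> (p \<in> N (z \<otimes> c)) = (p \<in> N (b \<otimes> k))"
      using crossing_edge[OF m_closed[OF b k] m_closed[OF b'(2) k] b'(2)] by blast
    have "k \<notin> N z" "k' \<in> N z" "k \<notin> N (z \<otimes> c)"
      using same[of k] same[of k'] bk b'bk k k' by auto
    note zc = zc this
    have "z \<otimes> c = b' \<otimes> z" using zc b' by (auto simp: conj_by_def m_assoc)
    then show False using flip[of z] zc by auto
  qed
  then have "b' \<in> N (b \<otimes> k)" using flip[of k] N_gen[of k] assms k neq by auto
  then have "b' = b \<or> conj_by b b' = k" using N_gen_mult[of b k b'] N_gen[of k] assms b' k by auto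
  moreover have "conj_by b b' \<noteq> k"
  proof
    assume "conj_by b b' = k"
    then have "b' = k'" using conj_by_inv_cancel(1)[of b b'] b' assms by (simp add: k'_def)
    then show False using neq by simp
  qed
  ultimately show ?thesis by (auto simp: b'_def)
qed

definition conj_class :: "'a \<Rightarrow> 'a set" where
  "conj_class c = (\<lambda>w. conj_by w c) ` carrier G"

lemma finite_image_factor:
  assumes "finite (\<phi> ` A)" "\<And>v w. v \<in> A \<Longrightarrow> w \<in> A \<Longrightarrow> \<phi> v = \<phi> w \<Longrightarrow> g v = g w"
  shows "finite (g ` A)"
proof -
  have "g ` A \<subseteq> (\<lambda>d. g (inv_into A \<phi> d)) ` \<phi> ` A"
  proof
    fix y assume "y \<in> g ` A"
    then obtain v where v: "v \<in> A" "y = g v" by auto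
    then have "y = g (inv_into A \<phi> (\<phi> v))"
      using assms(2)[of "inv_into A \<phi> (\<phi> v)" v] by (simp add: f_inv_into_f inv_into_into)
    then show "y \<in> (\<lambda>d. g (inv_into A \<phi> d)) ` \<phi> ` A" using v by blast
  qed
  then show ?thesis using assms(1) by (meson finite_imageI finite_subset)
qed

text \<open>
  The conjugate of \<open>b\<close> by \<open>w\<close> depends only on the conjugates of
  \<open>k\<close> and \<open>b k b\<close> by \<open>w\<close> and on the sides on which
  \<open>w\<close> places their walls: if \<open>v\<close> and \<open>w\<close> agree in these
  data, then \<open>fixes_neighbour\<close> applies to \<open>u = v\<inverse> w\<close>.
\<close>

lemma finite_class_neighbour:
  assumes "k \<in> S" "b \<in> S" "conj_by b k \<noteq> k" "finite (conj_class k)"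
  shows "finite (conj_class b)"
proof -
  define k' where "k' = conj_by b k"
  have k: "k \<in> carrier G" "k' \<in> carrier G" using assms by (auto simp: k'_def)
  define \<phi> where "\<phi> w = (conj_by w k, conj_by w k', k \<in> N (inv w), k' \<in> N (inv w))" for w
  have "\<phi> ` carrier G \<subseteq> conj_class k \<times> conj_class k \<times> UNIV \<times> UNIV"
  proof -
    have "conj_by w k' \<in> conj_class k" if "w \<in> carrier G" for w
      using that assms unfolding conj_class_def k'_def
      by (intro image_eqI[of _ _ "w \<otimes> b"]) (auto simp: conj_by_mult)
    then show ?thesis by (auto simp: \<phi>_def conj_class_def)
  qed
  then have "finite (\<phi> ` carrier G)" using assms(4)
    by (rule_tac finite_subset) (auto intro!: finite_cartesian_product)
  moreover have "conj_by v b = conj_by w b" if vw: "v \<in> carrier G" "w \<in> carrier G" "\<phi> v = \<phi> w" for v w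
  proof -
    let ?u = "inv v \<otimes> w"
    have eq: "conj_by v k = conj_by w k" "conj_by v k' = conj_by w k'"
      "k \<in> N (inv v) \<longleftrightarrow> k \<in> N (inv w)" "k' \<in> N (inv v) \<longleftrightarrow> k' \<in> N (inv w)"
      using vw by (auto simp: \<phi>_def)
    have *: "conj_by ?u t = t \<and> t \<notin> N ?u"
      if t: "t \<in> carrier G" "conj_by v t = conj_by w t" "t \<in> N (inv v) \<longleftrightarrow> t \<in> N (inv w)" for t
      using that vw N_mult[of "inv v" w t] N_inv[of w t] t(2)[symmetric] by (simp add: conj_by_mult)
    then have "conj_by ?u b = b"
      using fixes_neighbour[of k b ?u] *[of k] *[of k'] eq k assms vw by (simp add: k'_def)
    then have "conj_by (inv v) (conj_by w b) = b" using vw assms by (simp add: conj_by_mult)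
    then show ?thesis using vw assms conj_by_inv_cancel(1)[of v "conj_by w b"] by simp
  qed
  ultimately show ?thesis unfolding conj_class_def by (rule finite_image_factor)
qed

lemma infinite_conj_class:
  assumes "finite S" "infinite (carrier G)" "irreducible_gens G S" "s \<in> S"
  shows "infinite (conj_class s)"
proof
  assume fin: "finite (conj_class s)"
  define K where "K = {k \<in> S. finite (conj_class k)}"
  have "S \<subseteq> K \<union> cox_perp G S K"
  proof
    fix b assume b: "b \<in> S"
    have "b \<otimes> k = k \<otimes> b" if "b \<notin> K" "k \<in> K" for k
    proof (rule ccontr)
      assume "b \<otimes> k \<noteq> k \<otimes> b"
      then have "conj_by b k \<noteq> k" using conj_by_commute_iff[of b k] b that by (auto simp: K_def)
      then show False using finite_class_neighbour[of k b] b that by (auto simp: K_def)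
    qed
    then show "b \<in> K \<union> cox_perp G S K" using b by (auto simp: cox_perp_def)
  qed
  moreover have "K \<union> cox_perp G S K \<subseteq> S" by (auto simp: K_def cox_perp_def)
  moreover have "K \<noteq> {}" using fin assms by (auto simp: K_def)
  moreover have "K \<subseteq> S" by (auto simp: K_def)
  ultimately have "K = S" using assms(3) unfolding irreducible_gens_def by blast
  then have "finite (\<Union>k\<in>S. conj_class k)" using assms by (auto simp: K_def)
  moreover have "N x \<subseteq> (\<Union>k\<in>S. conj_class k)" if "x \<in> carrier G" for x
    using N_reflection[OF that] unfolding reflection_def conj_class_def by blast
  ultimately have "finite (N ` carrier G)" by (auto intro: finite_subset[of _ "Pow (\<Union>k\<in>S. conj_class k)"])
  then show False using N_inj assms(2) finite_imageD by blast
qed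

lemma finite_ball:
  assumes "finite S" shows "finite {x \<in> carrier G. len x \<le> n}"
proof -
  have "{x \<in> carrier G. len x \<le> n} \<subseteq> word_prod ` {ws. set ws \<subseteq> S \<and> length ws \<le> n}"
    using reduced_word by force
  then show ?thesis using finite_lists_length_le[OF assms] by (meson finite_imageI finite_subset)
qed

text \<open>
  Left multiplication by \<open>s\<close> is the symmetry that exchanges the two sides of the
  wall.
\<close>

lemma depth_other_side:
  assumes "s \<in> S" "x \<in> carrier G"
  shows "depth s (s \<otimes> x) = depth s x" "s \<in> N (s \<otimes> x) \<longleftrightarrow> s \<notin> N x"
  using assms by (simp_all add: depth_def inv_mult_group conj_by_mult conj_by_self N_gen_mult)

lemma depth_unbounded:
  assumes "finite S" "infinite (carrier G)" "irreducible_gens G S" "s \<in> S"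
  shows "\<exists>x\<in>carrier G. (s \<in> N x) = \<sigma> \<and> n \<le> depth s x"
proof -
  have "\<exists>x\<in>carrier G. n \<le> depth s x"
  proof (rule ccontr)
    assume neg: "\<not> ?thesis"
    have "conj_class s \<subseteq> {x \<in> carrier G. len x \<le> n}"
    proof
      fix t assume "t \<in> conj_class s"
      then obtain w where w: "w \<in> carrier G" "t = conj_by w s" by (auto simp: conj_class_def)
      then have "len t = depth s (inv w)" by (simp add: depth_def)
      moreover have "depth s (inv w) < n" using neg w by (meson inv_closed not_le)
      ultimately show "t \<in> {x \<in> carrier G. len x \<le> n}" using w assms by simp
    qed
    then show False using infinite_conj_class[OF assms] finite_ball[OF assms(1)] finite_subset by blast
  qed
  then obtain x where x: "x \<in> carrier G" "n \<le> depth s x" by blast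
  show ?thesis
  proof (cases "(s \<in> N x) = \<sigma>")
    case True
    then show ?thesis using x by blast
  next
    case False
    then show ?thesis using x assms depth_other_side[of s x] by (intro bexI[of _ "s \<otimes> x"]) auto
  qed
qed

text \<open>
  Finitely many elements of \<open>S\<close> generate the group, and no generator lies in the
  subgroup generated by the others, because the only descent of \<open>s \<in> S\<close> is
  \<open>s\<close>.
\<close>

lemma finite_generators:
  assumes "finitely_generated G" shows "finite S"
proof -
  obtain A where A: "finite A" "A \<subseteq> carrier G" "generate G A = carrier G"
    using assms by (auto simp: finitely_generated_def finite_generating_set_def)
  obtain f where f: "\<And>a. a \<in> A \<Longrightarrow> set (f a) \<subseteq> S \<and> word_prod (f a) = a"
    using ex_word A by (metis subsetD)
  define S0 where "S0 = (\<Union>a\<in>A. set (f a))"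
  have S0: "finite S0" "S0 \<subseteq> S" using A f by (auto simp: S0_def)
  have "a \<in> generate G S0" if "a \<in> A" for a
    using f[OF that] word_in_generate[of "f a" S0] that by (auto simp: S0_def)
  then have "generate G A \<subseteq> generate G S0"
    using generate_subgroup[OF S0(2)] by (simp add: generate_subgroup_incl subsetI)
  then have gen: "carrier G \<subseteq> generate G S0" using A by simp
  have "S \<subseteq> S0"
  proof
    fix s assume s: "s \<in> S"
    then have "s \<in> generate G S0" using gen S_in by blast
    then obtain a where "a \<in> S0" "a \<in> N s" using ex_descent[OF S0(2)] S_not_one[OF s] by blast
    then show "s \<in> S0" using N_gen[OF s] by simp
  qed
  then show ?thesis using S0 finite_subset by blast
qed

section \<open>Depth and distance to the centraliser\<close>

lemma len_conj_le:
  assumes "x \<in> carrier G" "t \<in> carrier G" shows "len (conj_by x t) \<le> len t + 2 * len x"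
proof -
  have "len (conj_by x t) \<le> len (x \<otimes> t) + len (inv x)"
    unfolding conj_by_def using assms by (intro len_mult_le) auto
  also have "\<dots> \<le> len x + len t + len x" using assms len_mult_le[of x t] by simp
  finally show ?thesis by simp
qed

lemma depth_mult_le:
  assumes "s \<in> S" "x \<in> carrier G" "y \<in> carrier G"
  shows "depth s (x \<otimes> y) \<le> depth s x + 2 * len y" "depth s x \<le> depth s (x \<otimes> y) + 2 * len y"
proof -
  have le: "depth s (x \<otimes> y) \<le> depth s x + 2 * len y" if "x \<in> carrier G" "y \<in> carrier G" for x y
    using that len_conj_le[of "inv y" "conj_by (inv x) s"] assms depth_mult[of s x y] by (simp add: depth_def)
  show "depth s (x \<otimes> y) \<le> depth s x + 2 * len y" using le assms by blast
  show "depth s x \<le> depth s (x \<otimes> y) + 2 * len y"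
    using le[of "x \<otimes> y" "inv y"] assms by (simp add: m_assoc)
qed

text \<open>
  A step by \<open>y\<close> crosses the wall of \<open>s\<close> only where the wall, as seen
  from \<open>x\<close>, separates \<open>1\<close> from \<open>y\<close>, and such walls have
  short reflections.
\<close>

lemma crossing_bound:
  assumes "s \<in> S" "x \<in> carrier G" "y \<in> carrier G" "2 * len y \<le> depth s x"
  shows "s \<in> N (x \<otimes> y) \<longleftrightarrow> s \<in> N x"
proof -
  have "conj_by (inv x) s \<notin> N y" using N_len_bound[of y "conj_by (inv x) s"] assms by (auto simp: depth_def)
  then show ?thesis using assms by (simp add: N_mult)
qed

lemma centraliser_iff: "s \<in> S \<Longrightarrow> w \<in> centraliser G s \<longleftrightarrow> w \<in> carrier G \<and> conj_by w s = s"
  by (auto simp: centraliser_def conj_by_commute_iff)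

lemma depth_centraliser: assumes "s \<in> S" "w \<in> centraliser G s" shows "depth s w = 1"
proof -
  have "w \<in> carrier G" "conj_by w s = s" using assms centraliser_iff by auto
  then have "conj_by (inv w) s = s" using conj_by_inv_cancel(2)[of w s] assms by simp
  then show ?thesis using assms by (simp add: depth_def len_gen)
qed

text \<open>
  Two elements \<open>w\<close>, \<open>v\<close> that see the same reflection
  \<open>w\<inverse> s w = v\<inverse> s v\<close> differ by left multiplication with an element
  of the centraliser; one \<open>v\<close> is chosen for each of the finitely many reflections
  of length at most \<open>n\<close>.
\<close>

lemma shallow_near_centraliser:
  assumes "finite S" "s \<in> S"
  shows "\<exists>V. finite V \<and> V \<subseteq> carrier G \<and>
    (\<forall>w\<in>carrier G. depth s w \<le> n \<longrightarrow> (\<exists>v\<in>V. w \<otimes> v \<in> centraliser G s))"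
proof -
  define R where "R = (\<lambda>w. conj_by (inv w) s) ` {w \<in> carrier G. depth s w \<le> n}"
  have "R \<subseteq> {x \<in> carrier G. len x \<le> n}" using assms by (auto simp: R_def depth_def)
  then have "finite R" using finite_ball[OF assms(1)] finite_subset by blast
  obtain v where v: "\<And>r. r \<in> R \<Longrightarrow> v r \<in> carrier G \<and> conj_by (inv (v r)) s = r"
  proof -
    have "\<forall>r\<in>R. \<exists>v. v \<in> carrier G \<and> conj_by (inv v) s = r" unfolding R_def by blast
    then obtain v where v: "\<forall>r\<in>R. v r \<in> carrier G \<and> conj_by (inv (v r)) s = r"
      by (rule bchoice[THEN exE])
    show thesis by (rule that[of v]) (use v in blast)
  qed
  have "w \<otimes> inv (v (conj_by (inv w) s)) \<in> centraliser G s" if w: "w \<in> carrier G" "depth s w \<le> n" for w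
  proof -
    have "conj_by (inv w) s \<in> R" using w by (auto simp: R_def)
    then show ?thesis using v w assms by (simp add: centraliser_iff conj_by_mult)
  qed
  moreover have "conj_by (inv w) s \<in> R" if "w \<in> carrier G" "depth s w \<le> n" for w using that by (auto simp: R_def)
  ultimately show ?thesis
    using \<open>finite R\<close> v by (intro exI[of _ "(\<lambda>r. inv (v r)) ` R"]) (auto intro!: finite_imageI)
qed

lemma deep_side_connected:
  assumes "\<And>a b. a \<in> S \<Longrightarrow> b \<in> S \<Longrightarrow> finite (generate G {a, b})" "s \<in> S"
    and "x \<in> carrier G" "y \<in> carrier G" "(s \<in> N x) = (s \<in> N y)" "n \<le> depth s x" "n \<le> depth s y"
  shows "(\<lambda>x y. x \<in> carrier G \<and> n \<le> depth s x \<and> (\<exists>c\<in>S. y = x \<otimes> c))\<^sup>*\<^sup>* x y"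
    (is "?R\<^sup>*\<^sup>* x y")
proof (cases "s \<in> N x")
  case False
  have "(deep_edge s n)\<^sup>*\<^sup>* x y" using False deep_part_connected assms by simp
  then show ?thesis by (rule rtranclp_mono[THEN predicate2D, rotated]) (auto simp: deep_edge_def)
next
  case True
  have "(deep_edge s n)\<^sup>*\<^sup>* (s \<otimes> x) (s \<otimes> y)"
    using True deep_part_connected[OF assms(1,2)] assms depth_other_side by simp
  moreover have "?R\<^sup>*\<^sup>* (s \<otimes> u) (s \<otimes> v)" if "(deep_edge s n)\<^sup>*\<^sup>* u v" for u v
    using that
  proof (induction rule: rtranclp_induct)
    case (step v w)
    have "?R (s \<otimes> v) (s \<otimes> w)"
      using step(2) assms(2) depth_other_side by (auto simp: deep_edge_def m_assoc)
    then show ?case by (rule rtranclp.rtrancl_into_rtrancl[OF step(3)])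
  qed auto
  ultimately have "?R\<^sup>*\<^sup>* (s \<otimes> (s \<otimes> x)) (s \<otimes> (s \<otimes> y))" by blast
  then show ?thesis using assms by simp
qed

end

section \<open>The cocycle of a Coxeter presentation\<close>

lemma odd_card_less_Suc:
  "odd (card {j. j < Suc m \<and> P j}) \<longleftrightarrow> odd (card {j. j < m \<and> P j}) \<noteq> P m"
proof -
  have "{j. j < Suc m \<and> P j} = (if P m then insert m {j. j < m \<and> P j} else {j. j < m \<and> P j})"
    by (auto simp: less_Suc_eq)
  then show ?thesis by simp
qed

lemma even_card_periodic:
  assumes "\<And>j::nat. P (j + n) = P j"
  shows "even (card {j. j < 2 * n \<and> P j})"
proof -
  have "{j. j < 2 * n \<and> P j} = {j. j < n \<and> P j} \<union> (\<lambda>j. j + n) ` {j. j < n \<and> P j}"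
  proof safe
    fix j assume j: "j < 2 * n" "P j" "j \<notin> (\<lambda>j. j + n) ` {j. j < n \<and> P j}"
    show "j < n"
    proof (rule ccontr)
      assume "\<not> j < n"
      then have "j = (j - n) + n" "j - n < n" using j by auto
      then show False using j assms[of "j - n"] by (metis (mono_tags, lifting) image_eqI mem_Collect_eq)
    qed
  qed (use assms in auto)
  moreover have "{j. j < n \<and> P j} \<inter> (\<lambda>j. j + n) ` {j. j < n \<and> P j} = {}" by auto
  moreover have "card ((\<lambda>j. j + n) ` {j. j < n \<and> P j}) = card {j. j < n \<and> P j}"
    by (intro card_image) (auto simp: inj_on_def)
  ultimately show ?thesis by (simp add: card_Un_disjoint)
qed

context group begin

text \<open>
  Whether the gallery spelled by the word crosses the wall of \<open>t\<close> an odd number of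
  times. A formal inverse is treated like the letter itself, since the letters will be
  involutions.
\<close>

primrec wall_parity :: "'a gword \<Rightarrow> 'a \<Rightarrow> bool" where
  "wall_parity [] t \<longleftrightarrow> False"
| "wall_parity (x # w) t \<longleftrightarrow> (t = fst x) \<noteq> wall_parity w (conj_by (inv (fst x)) t)"

context
  fixes S assumes S: "S \<subseteq> carrier G" and S_sq: "\<And>s. s \<in> S \<Longrightarrow> s \<otimes> s = \<one>"
begin

lemma gword_eval_closed [simp]: "w \<in> gwords S \<Longrightarrow> gword_eval G w \<in> carrier G"
  using S by (induction w) (auto simp: gwords_def)

lemma gwords_append [simp]: "u @ v \<in> gwords S \<longleftrightarrow> u \<in> gwords S \<and> v \<in> gwords S"
  by (auto simp: gwords_def)

lemma gwords_Cons [simp]: "x # v \<in> gwords S \<longleftrightarrow> fst x \<in> S \<and> v \<in> gwords S"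
  by (cases x) (auto simp: gwords_def)

lemma gwords_Nil [simp]: "[] \<in> gwords S" by (auto simp: gwords_def)

lemma involution_inv: "s \<in> S \<Longrightarrow> inv s = s"
  using S S_sq inv_eq_self by auto

lemma gword_eval_append:
  "u \<in> gwords S \<Longrightarrow> v \<in> gwords S \<Longrightarrow> gword_eval G (u @ v) = gword_eval G u \<otimes> gword_eval G v"
proof (induction u)
  case (Cons x u)
  then show ?case using S by (auto simp: m_assoc subsetD)
qed auto

lemma wall_parity_append:
  assumes "u \<in> gwords S" "v \<in> gwords S" "t \<in> carrier G"
  shows "wall_parity (u @ v) t \<longleftrightarrow>
    wall_parity u t \<noteq> wall_parity v (conj_by (inv (gword_eval G u)) t)"
  using assms
proof (induction u arbitrary: t)
  case (Cons x u)
  then have x: "fst x \<in> S" "fst x \<in> carrier G" "u \<in> gwords S" using S by auto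
  have ev: "gword_eval G (x # u) = fst x \<otimes> gword_eval G u" using x by (simp add: involution_inv)
  have "conj_by (inv (gword_eval G (x # u))) t = conj_by (inv (gword_eval G u)) (conj_by (inv (fst x)) t)"
    unfolding ev using x Cons.prems by (simp add: inv_mult_group conj_by_mult)
  then show ?case using Cons.IH[of "conj_by (inv (fst x)) t"] x Cons.prems by auto
qed auto

lemma conj_by_pow:
  assumes "s \<in> S" "t \<in> S"
  shows "conj_by ((s \<otimes> t) [^] (n::nat)) s = (s \<otimes> t) [^] (2 * n) \<otimes> s"
proof (induction n)
  case 0
  then show ?case using assms S by auto
next
  case (Suc n)
  have st: "s \<in> carrier G" "t \<in> carrier G" using assms S by auto
  have "conj_by ((s \<otimes> t) [^] Suc n) s = conj_by (s \<otimes> t) (conj_by ((s \<otimes> t) [^] n) s)"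
    unfolding nat_pow_Suc2[OF m_closed[OF st]] using st by (intro conj_by_mult) auto
  also have "\<dots> = (s \<otimes> t) \<otimes> (s \<otimes> t) [^] (2 * n) \<otimes> (s \<otimes> inv (s \<otimes> t))"
    using Suc st by (simp add: conj_by_def m_assoc)
  also have "s \<otimes> inv (s \<otimes> t) = (s \<otimes> t) \<otimes> s"
    using st assms involution_inv by (simp add: inv_mult_group m_assoc)
  also have "(s \<otimes> t) \<otimes> (s \<otimes> t) [^] (2 * n) \<otimes> ((s \<otimes> t) \<otimes> s) = (s \<otimes> t) [^] Suc (Suc (2 * n)) \<otimes> s"
  proof -
    have "(s \<otimes> t) \<otimes> (s \<otimes> t) [^] (2 * n) = (s \<otimes> t) [^] Suc (2 * n)"
      by (rule nat_pow_Suc2[symmetric]) (use st in simp)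
    then show ?thesis using st by (simp add: m_assoc)
  qed
  finally show ?case by simp
qed

lemma relator_eval:
  assumes "s \<in> S" "t \<in> S"
  shows "gword_eval G (concat (replicate n [(s, True), (t, True)])) = (s \<otimes> t) [^] n"
    and "concat (replicate n [(s, True), (t, True)]) \<in> gwords S"
proof -
  have st: "s \<in> carrier G" "t \<in> carrier G" using assms S by auto
  show "gword_eval G (concat (replicate n [(s, True), (t, True)])) = (s \<otimes> t) [^] n"
  proof (induction n)
    case (Suc n)
    then show ?case using st nat_pow_Suc2[of "s \<otimes> t" n] by (simp add: m_assoc)
  qed simp
  show "concat (replicate n [(s, True), (t, True)]) \<in> gwords S"
    using assms by (induction n) auto
qed

text \<open>
  Counted from \<open>0\<close>, the step number \<open>j\<close> of the gallery spelled by
  \<open>(s t)\<^sup>n\<close> crosses the wall of \<open>(s t)\<^sup>j s\<close>.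
\<close>

lemma wall_parity_relator_count:
  assumes "s \<in> S" "t \<in> S" "x \<in> carrier G"
  shows "wall_parity (concat (replicate n [(s, True), (t, True)])) x \<longleftrightarrow>
    odd (card {j. j < 2 * n \<and> x = (s \<otimes> t) [^] j \<otimes> s})"
proof (induction n)
  case (Suc n)
  let ?r = "s \<otimes> t"
  let ?P = "\<lambda>j. x = ?r [^] (j::nat) \<otimes> s"
  have st: "s \<in> carrier G" "t \<in> carrier G" "inv s = s" "inv t = t" using assms S involution_inv by auto
  define y where "y = conj_by (inv (?r [^] n)) x"
  have y: "y \<in> carrier G" using st assms by (simp add: y_def)
  have y_eq: "y = z \<longleftrightarrow> x = conj_by (?r [^] n) z" if "z \<in> carrier G" for z
    using that st assms by (auto simp: y_def)
  have "concat (replicate (Suc n) [(s, True), (t, True)]) =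
      concat (replicate n [(s, True), (t, True)]) @ [(s, True), (t, True)]"
    by (simp flip: replicate_append_same)
  then have "wall_parity (concat (replicate (Suc n) [(s, True), (t, True)])) x \<longleftrightarrow>
      odd (card {j. j < 2 * n \<and> ?P j}) \<noteq> ((y = s) \<noteq> (conj_by s y = t))"
    using Suc relator_eval[OF assms(1,2), of n] assms st
      wall_parity_append[of "concat (replicate n [(s, True), (t, True)])" "[(s, True), (t, True)]" x]
    by (simp add: y_def)
  also have "y = s \<longleftrightarrow> ?P (2 * n)" using y_eq[of s] st conj_by_pow assms by simp
  also have "conj_by s y = t \<longleftrightarrow> y = ?r \<otimes> s"
    using conj_by_eq_iff[of s y t] y st by (auto simp: conj_by_def)
  also have "y = ?r \<otimes> s \<longleftrightarrow> ?P (Suc (2 * n))"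
  proof -
    have "conj_by (?r [^] n) (?r \<otimes> s) = conj_by (?r [^] n) ?r \<otimes> conj_by (?r [^] n) s"
      using st by (simp add: conj_by_distrib)
    also have "conj_by (?r [^] n) ?r = ?r"
      using st nat_pow_Suc2[of ?r n] conj_by_commute_iff[of "?r [^] n" ?r] by simp
    also have "?r \<otimes> conj_by (?r [^] n) s = ?r [^] Suc (2 * n) \<otimes> s"
      using st conj_by_pow[OF assms(1,2)] nat_pow_Suc2[of ?r "2 * n"] by (simp add: m_assoc)
    finally show ?thesis using y_eq[of "?r \<otimes> s"] st by simp
  qed
  also have "odd (card {j. j < 2 * n \<and> ?P j}) \<noteq> (?P (2 * n) \<noteq> ?P (Suc (2 * n))) \<longleftrightarrow>
      odd (card {j. j < Suc (Suc (2 * n)) \<and> ?P j})"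
    unfolding odd_card_less_Suc by blast
  finally show ?case by simp
qed simp

text \<open>
  As \<open>(s t)\<^sup>n = 1\<close>, the sequence of walls crossed has period
  \<open>n\<close>, and its length is \<open>2 n\<close>; so every wall is crossed an even
  number of times.
\<close>

lemma wall_parity_relator:
  assumes "s \<in> S" "t \<in> S" "x \<in> carrier G" "(s \<otimes> t) [^] n = \<one>"
  shows "\<not> wall_parity (concat (replicate n [(s, True), (t, True)])) x"
proof -
  have "(s \<otimes> t) [^] (j + n) = (s \<otimes> t) [^] j" for j
    using assms S nat_pow_mult[of "s \<otimes> t" j n] by (auto simp: subsetD)
  then show ?thesis using assms by (simp add: wall_parity_relator_count even_card_periodic)
qed

text \<open>
  Inserting a cancelling pair of letters or a relator changes the number of crossings of each
  wall by an even number.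
\<close>

lemma pres_eq_wall_parity:
  assumes "pres_eq S (coxeter_relators S m) v w"
    and pres: "presented_by G S (coxeter_relators S m)"
  shows "v \<in> gwords S \<and> w \<in> gwords S \<and> (\<forall>t\<in>carrier G. wall_parity v t = wall_parity w t)"
  using assms(1)
proof induction
  case (cancel u v s b)
  then have s: "s \<in> S" "s \<in> carrier G" "inv s = s" using S involution_inv by auto
  have "wall_parity ([(s, b), (s, \<not> b)] @ v) t = wall_parity v t" if "t \<in> carrier G" for t
    using that s conj_by_eq_iff[of s t s] by (auto simp: conj_by_self S_sq simp flip: conj_by_mult)
  then show ?case using cancel s by (auto simp: wall_parity_append)
next
  case (relator u v r)
  then obtain s t n where r: "r = concat (replicate n [(s, True), (t, True)])" "s \<in> S" "t \<in> S"
    by (auto simp: coxeter_relators_def)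
  have "pres_eq S (coxeter_relators S m) ([] @ r @ []) ([] @ [])"
    using relator by (intro pres_eq.relator) auto
  then have "gword_eval G r = \<one>"
    using pres relator unfolding presented_by_def by (metis append.right_neutral append_Nil gword_eval.simps(1) gwords_Nil)
  then have rel: "(s \<otimes> t) [^] n = \<one>" "gword_eval G r = \<one>" using relator_eval(1) r by auto
  have "wall_parity (r @ v) x = wall_parity v x" if "x \<in> carrier G" for x
    using that rel r wall_parity_relator[of s t x n] relator by (simp add: wall_parity_append)
  then show ?case using relator by (auto simp: wall_parity_append)
qed auto

lemma ex_gword:
  assumes "generate G S = carrier G" "x \<in> carrier G"
  shows "\<exists>w\<in>gwords S. gword_eval G w = x"
proof -
  have "x \<in> generate G S" using assms by simp
  then show ?thesis
  proof induction
    case one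
    show ?case by (intro bexI[of _ "[]"]) auto
  next
    case (incl h)
    then show ?case using S by (intro bexI[of _ "[(h, True)]"]) auto
  next
    case (inv h)
    then show ?case using S by (intro bexI[of _ "[(h, False)]"]) auto
  next
    case (eng h1 h2)
    then show ?case using gword_eval_append gwords_append by metis
  qed
qed

lemma reflection_cocycle_of_presentation:
  assumes pres: "presented_by G S (coxeter_relators S m)"
  shows "reflection_cocycle G S (\<lambda>x. {t \<in> carrier G. \<exists>w\<in>gwords S. gword_eval G w = x \<and> wall_parity w t})"
    (is "reflection_cocycle G S ?N")
proof -
  have gen: "generate G S = carrier G" using pres by (simp add: presented_by_def)
  have N_eval: "t \<in> ?N (gword_eval G w) \<longleftrightarrow> wall_parity w t" if "w \<in> gwords S" "t \<in> carrier G" for w t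
    using that pres_eq_wall_parity[OF _ pres] pres unfolding presented_by_def by blast
  show ?thesis
  proof unfold_locales
    show "S \<subseteq> carrier G" "generate G S = carrier G" using S gen .
    show "s \<otimes> s = \<one>" if "s \<in> S" for s using S_sq that .
    show "?N x \<subseteq> carrier G" for x by auto
    show "?N s = {s}" if "s \<in> S" for s
    proof -
      have "gword_eval G [(s, True)] = s" "[(s, True)] \<in> gwords S" using that S by auto
      then have "t \<in> ?N s \<longleftrightarrow> t = s" if "t \<in> carrier G" for t
        using N_eval[of "[(s, True)]" t] that by simp
      then show ?thesis using that S by blast
    qed
    fix x y t assume xyt: "x \<in> carrier G" "y \<in> carrier G" "t \<in> carrier G"
    obtain u v where uv: "u \<in> gwords S" "gword_eval G u = x" "v \<in> gwords S" "gword_eval G v = y"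
      using ex_gword[OF gen] xyt by meson
    then have xy: "x \<otimes> y = gword_eval G (u @ v)" using gword_eval_append by simp
    show "t \<in> ?N (x \<otimes> y) \<longleftrightarrow> (t \<in> ?N x) \<noteq> (conj_by (inv x) t \<in> ?N y)"
      unfolding xy using N_eval[of "u @ v" t] N_eval[of u t] N_eval[of v "conj_by (inv x) t"] uv xyt
      by (simp add: wall_parity_append)
  qed
qed

end

theorem coxeter_reflection_cocycle:
  assumes "coxeter_generating_set G S"
  shows "\<exists>N. reflection_cocycle G S N"
proof -
  obtain m where m: "coxeter_matrix_on S m" and pres: "presented_by G S (coxeter_relators S m)"
    using assms by (auto simp: coxeter_generating_set_def)
  have S: "S \<subseteq> carrier G" using pres by (simp add: presented_by_def)
  have sq: "s \<otimes> s = \<one>" if s: "s \<in> S" for s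
  proof -
    let ?r = "[(s, True), (s, True)]"
    have "m s s = enat 1" using m s by (simp add: coxeter_matrix_on_def one_enat_def)
    then have "?r \<in> coxeter_relators S m"
      using s unfolding coxeter_relators_def by (intro CollectI exI[of _ s] exI[of _ 1]) auto
    moreover have "?r \<in> gwords S" "[] \<in> gwords S" using s by (auto simp: gwords_def)
    ultimately have "pres_eq S (coxeter_relators S m) ([] @ ?r @ []) ([] @ [])"
      by (intro pres_eq.relator)
    then have "gword_eval G ?r = gword_eval G []"
      using pres \<open>?r \<in> gwords S\<close> \<open>[] \<in> gwords S\<close> unfolding presented_by_def
      by (simp del: gword_eval.simps)
    then show ?thesis using s S by auto
  qed
  show ?thesis using reflection_cocycle_of_presentation[OF S sq pres] by blast
qed

end

section \<open>The Cayley graph of a finite generating set\<close>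

text \<open>
  In barycentric coordinates this is the extension of a function on the vertices that is affine
  on every edge.
\<close>

definition linear_extension :: "('a \<Rightarrow> real) \<Rightarrow> ('a \<Rightarrow> real) \<Rightarrow> real" where
  "linear_extension F p = (\<Sum>v | p v \<noteq> 0. p v * F v)"

lemma linear_extension_cell:
  assumes "finite e" "p \<in> closed_cell e"
  shows "linear_extension F p = (\<Sum>v\<in>e. p v * F v)"
  unfolding linear_extension_def
  by (rule sum.mono_neutral_left) (use assms in \<open>auto simp: closed_cell_def\<close>)

lemma linear_extension_vertex [simp]: "linear_extension F (cayley_vertex g) = F g"
proof -
  have "cayley_vertex g \<in> closed_cell {g}" by (simp add: cayley_vertex_in_cell)
  then show ?thesis using linear_extension_cell[of "{g}" "cayley_vertex g" F] by (simp add: cayley_vertex_def)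
qed

lemma linear_extension_gt:
  assumes "e = {u, v}" "p \<in> closed_cell e" "F u > c" "F v > c"
  shows "linear_extension F p > c"
proof -
  have p: "0 \<le> p u" "0 \<le> p v" "sum p e = 1" using assms by (auto simp: closed_cell_def)
  have *: "linear_extension F p = (\<Sum>v\<in>e. p v * F v)" using assms by (intro linear_extension_cell) auto
  show ?thesis
  proof (cases "u = v")
    case True
    then show ?thesis using * p assms by simp
  next
    case False
    then have pv: "p v = 1 - p u" and "linear_extension F p = p u * F u + p v * F v"
      using p * assms by auto
    then have "linear_extension F p = p u * F u + (1 - p u) * F v" by simp
    then have "linear_extension F p - c = p u * (F u - c) + (1 - p u) * (F v - c)" by (simp add: algebra_simps)
    then have "linear_extension F p - c = p u * (F u - c) + p v * (F v - c)" by (simp add: pv)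
    moreover have "p u * (F u - c) + p v * (F v - c) > 0"
    proof (cases "p u = 0")
      case True
      then show ?thesis using pv assms by simp
    next
      case False
      then show ?thesis using p assms by (intro add_pos_nonneg mult_pos_pos mult_nonneg_nonneg) auto
    qed
    ultimately show ?thesis by simp
  qed
qed

lemma linear_extension_const:
  assumes "e = {u, v}" "p \<in> closed_cell e" "F u = c" "F v = c"
  shows "linear_extension F p = c"
proof -
  have "linear_extension F p = (\<Sum>v\<in>e. p v * F v)" using assms by (intro linear_extension_cell) auto
  also have "\<dots> = (\<Sum>v\<in>e. p v) * c" unfolding sum_distrib_right by (rule sum.cong) (use assms in auto)
  finally show ?thesis using assms by (simp add: closed_cell_def)
qed

lemma segment_length_cell:
  assumes "u \<noteq> v" "p \<in> closed_cell {u, v}" "q \<in> closed_cell {u, v}"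
  shows "segment_length p q = \<bar>p u - q u\<bar>"
proof -
  have off: "x \<notin> {u, v} \<Longrightarrow> p x = 0 \<and> q x = 0" for x using assms by (auto simp: closed_cell_def)
  have "(\<Sum>x | p x \<noteq> q x. \<bar>p x - q x\<bar>) = (\<Sum>x\<in>{u, v}. \<bar>p x - q x\<bar>)"
    by (rule sum.mono_neutral_left) (use off in fastforce)+
  moreover have "p u + p v = 1" "q u + q v = 1" using assms by (auto simp: closed_cell_def)
  ultimately show ?thesis using assms(1) by (auto simp: segment_length_def)
qed

lemma closed_cell_singleton: "closed_cell {u} = {cayley_vertex u}"
  by (auto simp: closed_cell_def cayley_vertex_def fun_eq_iff)

lemma segment_length_self [simp]: "segment_length p p = 0"
  by (simp add: segment_length_def)

locale cayley = group G for G (structure) +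
  fixes A :: "'a set"
  assumes A_finite: "finite A" and A_carrier: "A \<subseteq> carrier G" and A_generate: "generate G A = carrier G"
begin

abbreviation "X \<equiv> cayley_graph G A"
abbreviation "d \<equiv> cayley_dist G A"
abbreviation "T \<equiv> cayley_topology G A"

sublocale Metric_space X d
  using Metric_space_cayley A_carrier A_generate is_group by blast

lemma T_eq: "T = mtopology" by (simp add: cayley_topology_def)

lemma topspace_T [simp]: "topspace T = X" by (simp only: T_eq topspace_mtopology)

lemma A_in [simp]: "a \<in> A \<Longrightarrow> a \<in> carrier G" using A_carrier by auto

lemma cell_in_X: "e \<in> cayley_cells G A \<Longrightarrow> closed_cell e \<subseteq> X" by (auto simp: cayley_graph_def)

lemma X_cell: "x \<in> X \<Longrightarrow> \<exists>e\<in>cayley_cells G A. x \<in> closed_cell e" by (auto simp: cayley_graph_def)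

lemma cell_cases:
  assumes "e \<in> cayley_cells G A"
  obtains g where "g \<in> carrier G" "e = {g}" | g a where "g \<in> carrier G" "a \<in> A" "e = {g, g \<otimes> a}"
  using assms by (auto simp: cayley_cells_def)

lemma vertex_cell: "g \<in> carrier G \<Longrightarrow> {g} \<in> cayley_cells G A" by (auto simp: cayley_cells_def)

lemma edge_cell: "g \<in> carrier G \<Longrightarrow> a \<in> A \<Longrightarrow> {g, g \<otimes> a} \<in> cayley_cells G A"
  by (auto simp: cayley_cells_def)

lemma cell_carrier: "e \<in> cayley_cells G A \<Longrightarrow> e \<subseteq> carrier G"
  by (auto simp: cayley_cells_def)

lemma cell_finite: "e \<in> cayley_cells G A \<Longrightarrow> finite e"
  by (auto simp: cayley_cells_def)

lemma vertex_in_X [simp]: "g \<in> carrier G \<Longrightarrow> cayley_vertex g \<in> X"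
  using cell_in_X[OF vertex_cell] cayley_vertex_in_cell[of "{g}" g] by auto

lemma dist_le_path:
  assumes "x \<in> X" "y \<in> X" "ps \<in> polygonal_paths G A x y"
  shows "d x y \<le> path_length ps"
proof -
  have "bdd_below (path_length ` polygonal_paths G A x y)" by (meson bdd_belowI2 path_length_nonneg)
  then show ?thesis using assms by (auto simp: cayley_dist_def intro: cINF_lower)
qed

lemma dist_cell:
  assumes "e \<in> cayley_cells G A" "x \<in> closed_cell e" "y \<in> closed_cell e"
  shows "d x y \<le> segment_length x y"
  using dist_le_path[of x y "[x, y]"] polygonal_paths_cell[OF assms] cell_in_X assms by auto

lemma segment_length_le_1:
  assumes "e \<in> cayley_cells G A" "x \<in> closed_cell e" "y \<in> closed_cell e"
  shows "segment_length x y \<le> 1"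
proof -
  obtain u v where e: "e = {u, v}" using cayley_cell_card[OF assms(1)] by blast
  show ?thesis
  proof (cases "u = v")
    case True
    then show ?thesis using assms e by (simp add: closed_cell_singleton)
  next
    case False
    have *: "0 \<le> p u \<and> p u \<le> 1" if "p \<in> closed_cell e" for p
    proof -
      have "0 \<le> p u" "0 \<le> p v" "p u + p v = 1" using that False e by (auto simp: closed_cell_def)
      then show ?thesis by linarith
    qed
    have "segment_length x y = \<bar>x u - y u\<bar>" using segment_length_cell[OF False] assms e by simp
    then show ?thesis using *[OF assms(2)] *[OF assms(3)] by linarith
  qed
qed

text \<open>
  The bound is the word length of \<open>h\<close> with respect to \<open>A\<close>.
\<close>

lemma dist_mult_bounded:
  assumes "h \<in> carrier G"
  shows "\<exists>L. \<forall>g\<in>carrier G. d (cayley_vertex g) (cayley_vertex (g \<otimes> h)) \<le> L"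
proof -
  have edge: "d (cayley_vertex g) (cayley_vertex (g \<otimes> a)) \<le> 1" if "g \<in> carrier G" "a \<in> A" for g a
  proof -
    have "cayley_vertex g \<in> closed_cell {g, g \<otimes> a}" "cayley_vertex (g \<otimes> a) \<in> closed_cell {g, g \<otimes> a}"
      by (auto intro: cayley_vertex_in_cell)
    then show ?thesis using dist_cell[OF edge_cell[OF that]] segment_length_le_1[OF edge_cell[OF that]]
      by (meson order_trans)
  qed
  have "h \<in> generate G A" using assms A_generate by simp
  then show ?thesis
  proof induction
    case one
    then show ?case by (intro exI[of _ 0]) (auto simp: mdist_zero)
  next
    case (incl a)
    then show ?case using edge by auto
  next
    case (inv a)
    have "d (cayley_vertex g) (cayley_vertex (g \<otimes> inv a)) \<le> 1" if "g \<in> carrier G" for g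
      using edge[of "g \<otimes> inv a" a] inv that commute[of "cayley_vertex g"] by (simp add: m_assoc)
    then show ?case by auto
  next
    case (eng h1 h2)
    have h: "h1 \<in> carrier G" "h2 \<in> carrier G" using eng generate_in_carrier A_carrier by blast+
    obtain L1 L2 where L: "\<forall>g\<in>carrier G. d (cayley_vertex g) (cayley_vertex (g \<otimes> h1)) \<le> L1"
      "\<forall>g\<in>carrier G. d (cayley_vertex g) (cayley_vertex (g \<otimes> h2)) \<le> L2" using eng by blast
    have "d (cayley_vertex g) (cayley_vertex (g \<otimes> (h1 \<otimes> h2))) \<le> L1 + L2" if g: "g \<in> carrier G" for g
    proof -
      have "d (cayley_vertex g) (cayley_vertex (g \<otimes> h1 \<otimes> h2)) \<le>
          d (cayley_vertex g) (cayley_vertex (g \<otimes> h1)) + d (cayley_vertex (g \<otimes> h1)) (cayley_vertex (g \<otimes> h1 \<otimes> h2))"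
        using g h by (intro triangle) auto
      also have "\<dots> \<le> L1 + L2" using L g h by (intro add_mono) auto
      finally show ?thesis using g h by (simp add: m_assoc)
    qed
    then show ?case by blast
  qed
qed

lemma linear_extension_path:
  assumes "M > 0" "\<And>g a. g \<in> carrier G \<Longrightarrow> a \<in> A \<Longrightarrow> \<bar>F g - F (g \<otimes> a)\<bar> \<le> M"
    and "ps \<in> polygonal_paths G A p q"
  shows "\<bar>linear_extension F p - linear_extension F q\<bar> \<le> M * path_length ps"
  using assms(3)
proof (induction ps arbitrary: p rule: path_length.induct)
  case (1 x y ps)
  then have y: "y # ps \<in> polygonal_paths G A y q" and x: "x = p" by (auto simp: polygonal_paths_def)
  obtain e where e: "e \<in> cayley_cells G A" "x \<in> closed_cell e" "y \<in> closed_cell e"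
    using 1(2) by (auto simp: polygonal_paths_def)
  have "\<bar>linear_extension F x - linear_extension F y\<bar> \<le> M * segment_length x y"
    using e(1)
  proof (cases rule: cell_cases)
    case (1 g)
    then show ?thesis using e by (simp add: closed_cell_singleton)
  next
    case (2 g a)
    show ?thesis
    proof (cases "g = g \<otimes> a")
      case True
      then show ?thesis using 2 e by (simp add: closed_cell_singleton)
    next
      case False
      have seg: "segment_length x y = \<bar>x g - y g\<bar>" using segment_length_cell[OF False] 2 e by simp
      have "x g + x (g \<otimes> a) = 1" "y g + y (g \<otimes> a) = 1" using e 2 False by (auto simp: closed_cell_def)
      then have xy: "x (g \<otimes> a) = 1 - x g" "y (g \<otimes> a) = 1 - y g" by linarith+
      have "linear_extension F x = x g * F g + x (g \<otimes> a) * F (g \<otimes> a)"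
        "linear_extension F y = y g * F g + y (g \<otimes> a) * F (g \<otimes> a)"
        using linear_extension_cell[OF cell_finite[OF e(1)]] e 2 False by auto
      then have "linear_extension F x - linear_extension F y = (x g - y g) * (F g - F (g \<otimes> a))"
        using xy by (simp add: algebra_simps)
      then have "\<bar>linear_extension F x - linear_extension F y\<bar> = \<bar>x g - y g\<bar> * \<bar>F g - F (g \<otimes> a)\<bar>"
        by (simp add: abs_mult)
      also have "\<dots> \<le> \<bar>x g - y g\<bar> * M" using assms(2) 2 by (intro mult_left_mono) auto
      finally show ?thesis using seg by (simp add: mult.commute)
    qed
  qed
  moreover have "\<bar>linear_extension F y - linear_extension F q\<bar> \<le> M * path_length (y # ps)"
    using 1(1) y by blast
  ultimately show ?case using x by (simp add: algebra_simps)
qed (auto simp: polygonal_paths_def)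

text \<open>
  A function on the vertices that varies by at most \<open>M\<close> along edges bounds the
  path-metric from below.
\<close>

lemma linear_extension_lipschitz:
  assumes "M > 0" "\<And>g a. g \<in> carrier G \<Longrightarrow> a \<in> A \<Longrightarrow> \<bar>F g - F (g \<otimes> a)\<bar> \<le> M"
    and "p \<in> X" "q \<in> X"
  shows "\<bar>linear_extension F p - linear_extension F q\<bar> \<le> M * d p q"
proof -
  have "\<bar>linear_extension F p - linear_extension F q\<bar> / M \<le> (INF ps\<in>polygonal_paths G A p q. path_length ps)"
    using linear_extension_path[OF assms(1,2)] assms(1)
      polygonal_paths_nonempty[OF is_group A_carrier A_generate assms(3,4)]
    by (intro cINF_greatest) (auto simp: field_simps)
  then show ?thesis using assms by (simp add: cayley_dist_def field_simps)
qed

lemma linear_extension_continuous: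
  assumes "M > 0" "\<And>g a. g \<in> carrier G \<Longrightarrow> a \<in> A \<Longrightarrow> \<bar>F g - F (g \<otimes> a)\<bar> \<le> M"
  shows "continuous_map T euclideanreal (linear_extension F)"
proof -
  have "\<exists>\<delta>>0. \<forall>x. x \<in> X \<and> d a x < \<delta> \<longrightarrow> dist (linear_extension F a) (linear_extension F x) < \<epsilon>"
    if "a \<in> X" "\<epsilon> > 0" for a \<epsilon>
  proof (intro exI[of _ "\<epsilon> / M"] conjI allI impI)
    show "0 < \<epsilon> / M" using that assms by simp
    fix x assume x: "x \<in> X \<and> d a x < \<epsilon> / M"
    have "\<bar>linear_extension F a - linear_extension F x\<bar> \<le> M * d a x"
      using linear_extension_lipschitz[OF assms] that x by blast
    also have "\<dots> < \<epsilon>" using x assms by (simp add: field_simps)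
    finally show "dist (linear_extension F a) (linear_extension F x) < \<epsilon>" by (simp add: dist_real_def)
  qed
  then have "continuous_map mtopology Met_TC.mtopology (linear_extension F)"
    by (subst metric_continuous_map[OF Met_TC.Metric_space_axioms]) auto
  then show ?thesis by (simp add: T_eq)
qed

text \<open>
  A cell is the continuous image of an interval, since the segment parametrisation does not
  increase distances.
\<close>

lemma cell_connected:
  assumes "e \<in> cayley_cells G A" "p \<in> closed_cell e" "q \<in> closed_cell e"
  shows "\<exists>C. connectedin T C \<and> p \<in> C \<and> q \<in> C \<and> C \<subseteq> closed_cell e"
proof -
  define \<gamma> where "\<gamma> t = (\<lambda>v. (1 - t) * p v + t * q v)" for t :: real
  have \<gamma>_cell: "\<gamma> t \<in> closed_cell e" if "t \<in> {0..1}" for t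
    using assms that by (auto simp: \<gamma>_def closed_cell_def sum.distrib simp flip: sum_distrib_left)
  have seg: "segment_length (\<gamma> t) (\<gamma> u) \<le> \<bar>t - u\<bar>" if "t \<in> {0..1}" "u \<in> {0..1}" for t u
  proof (cases "t = u")
    case False
    have "\<gamma> t v - \<gamma> u v = (t - u) * (q v - p v)" for v by (simp add: \<gamma>_def algebra_simps)
    then have eq: "\<bar>\<gamma> t v - \<gamma> u v\<bar> = \<bar>t - u\<bar> * \<bar>p v - q v\<bar>" for v
      by (simp add: abs_mult abs_minus_commute)
    then have "{v. \<gamma> t v \<noteq> \<gamma> u v} = {v. p v \<noteq> q v}"
    proof -
      have "\<gamma> t v \<noteq> \<gamma> u v \<longleftrightarrow> p v \<noteq> q v" for v using eq[of v] False by auto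
      then show ?thesis by simp
    qed
    then have "segment_length (\<gamma> t) (\<gamma> u) = \<bar>t - u\<bar> * segment_length p q"
      by (simp add: segment_length_def eq sum_distrib_left)
    also have "\<dots> \<le> \<bar>t - u\<bar> * 1" using segment_length_le_1[OF assms] by (intro mult_left_mono) auto
    finally show ?thesis by simp
  qed simp
  have "continuous_map (top_of_set {0..1}) T \<gamma>"
    unfolding T_eq continuous_map_to_metric
  proof (intro ballI allI impI)
    fix t \<epsilon> :: real assume t: "t \<in> topspace (top_of_set {0..1})" and \<epsilon>: "\<epsilon> > 0"
    show "\<exists>U. openin (top_of_set {0..1}) U \<and> t \<in> U \<and> (\<forall>y\<in>U. \<gamma> y \<in> mball (\<gamma> t) \<epsilon>)"
    proof (intro exI[of _ "{0..1} \<inter> ball t \<epsilon>"] conjI ballI)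
      show "openin (top_of_set {0..1}) ({0..1} \<inter> ball t \<epsilon>)" by (simp add: openin_open_Int)
      show "t \<in> {0..1} \<inter> ball t \<epsilon>" using t \<epsilon> by simp
      fix u assume u: "u \<in> {0..1} \<inter> ball t \<epsilon>"
      have "d (\<gamma> t) (\<gamma> u) \<le> \<bar>t - u\<bar>"
        by (rule order_trans[OF dist_cell[OF assms(1) \<gamma>_cell \<gamma>_cell] seg]) (use t u in auto)
      then show "\<gamma> u \<in> mball (\<gamma> t) \<epsilon>"
        using \<gamma>_cell[of t] \<gamma>_cell[of u] cell_in_X[OF assms(1)] t u by (auto simp: in_mball dist_real_def)
    qed
  qed
  moreover have "connectedin (top_of_set {0..1}) {0..1::real}"
    by (simp add: connectedin_subtopology)
  ultimately have "connectedin T (\<gamma> ` {0..1})" by (rule connectedin_continuous_map_image)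
  moreover have "p \<in> \<gamma> ` {0..1}" by (rule image_eqI[of _ _ 0]) (auto simp: \<gamma>_def)
  moreover have "q \<in> \<gamma> ` {0..1}" by (rule image_eqI[of _ _ 1]) (auto simp: \<gamma>_def)
  ultimately show ?thesis using \<gamma>_cell by blast
qed

end

section \<open>Two poles from two connected sides\<close>

lemma component_eqI:
  assumes "C \<in> connected_components_of Y" "x \<in> C" shows "C = connected_component_of_set Y x"
proof -
  obtain y where "C = connected_component_of_set Y y" using assms by (auto simp: connected_components_of_def)
  then show ?thesis using assms connected_component_of_equiv[of Y y x] by auto
qed

text \<open>
  \<open>F\<close> plays the part of a height above \<open>H\<close>, comparable with the
  distance to \<open>H\<close> in both directions (\<open>F_lipschitz\<close> with
  \<open>F_H\<close>, and \<open>near_H\<close>). High up, the two sides are not joined by edges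
  (\<open>side_const\<close>), each side is connected (\<open>deep_connected\<close>), and each
  side reaches arbitrarily high (\<open>F_unbounded\<close>). The Cayley graph is that of
  \<open>A\<close>, while the connecting paths take steps in a finite set \<open>B\<close>:
  depth is well-behaved along the Coxeter generators, but the poles are to be counted for every
  \<open>A\<close>.
\<close>

locale coarse_half_spaces = cayley +
  fixes H :: "'a set" and F :: "'a \<Rightarrow> real" and side :: "'a \<Rightarrow> bool" and B :: "'a set" and M :: real
  assumes H_nonempty: "H \<noteq> {}" and H_carrier: "H \<subseteq> carrier G" and F_H: "h \<in> H \<Longrightarrow> F h \<le> 1"
    and M_pos: "M > 0"
    and F_lipschitz: "g \<in> carrier G \<Longrightarrow> a \<in> A \<Longrightarrow> \<bar>F g - F (g \<otimes> a)\<bar> \<le> M"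
    and near_H: "\<exists>K. \<forall>g\<in>carrier G. F g \<le> real n \<longrightarrow> (\<exists>h\<in>H. d (cayley_vertex g) (cayley_vertex h) \<le> K)"
    and side_const: "\<exists>n. \<forall>g\<in>carrier G. \<forall>a\<in>A. real n < F g \<longrightarrow> side (g \<otimes> a) = side g"
    and B_finite: "finite B" and B_carrier: "B \<subseteq> carrier G"
    and deep_connected: "g \<in> carrier G \<Longrightarrow> h \<in> carrier G \<Longrightarrow> real n \<le> F g \<Longrightarrow> real n \<le> F h \<Longrightarrow>
      side g = side h \<Longrightarrow> (\<lambda>x y. x \<in> carrier G \<and> real n \<le> F x \<and> (\<exists>b\<in>B. y = x \<otimes> b))\<^sup>*\<^sup>* g h"
    and F_unbounded: "\<exists>g\<in>carrier G. side g = \<sigma> \<and> real n \<le> F g"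
begin

definition far :: "nat \<Rightarrow> ('a \<Rightarrow> real) set" where
  "far k = X - cayley_nbhd G A k H"

definition joined :: "nat \<Rightarrow> ('a \<Rightarrow> real) \<Rightarrow> ('a \<Rightarrow> real) \<Rightarrow> bool" where
  "joined k = connected_component_of (subtopology T (far k))"

lemma topspace_far: "topspace (subtopology T (far k)) = far k"
  unfolding topspace_subtopology topspace_T far_def by blast

lemma joined_trans: "joined k x y \<Longrightarrow> joined k y z \<Longrightarrow> joined k x z"
  unfolding joined_def by (rule connected_component_of_trans)

lemma joined_sym: "joined k x y \<Longrightarrow> joined k y x"
  unfolding joined_def by (simp add: connected_component_of_sym)

lemma joined_refl: "x \<in> far k \<Longrightarrow> joined k x x"
  unfolding joined_def by (simp only: connected_component_of_refl topspace_far)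

lemma far_antimono: "k \<le> l \<Longrightarrow> far l \<subseteq> far k"
  by (auto simp: far_def cayley_nbhd_def)

lemma joined_mono: "joined l x y \<Longrightarrow> k \<le> l \<Longrightarrow> joined k x y"
  unfolding joined_def by (rule connected_component_of_mono[OF _ far_antimono])

lemma nbhd_bound: assumes "x \<in> cayley_nbhd G A k H" shows "linear_extension F x \<le> 1 + M * k"
proof -
  have x: "x \<in> X" and inf: "(INF h\<in>H. d x (cayley_vertex h)) \<le> k" using assms by (auto simp: cayley_nbhd_def)
  have "(linear_extension F x - 1) / M \<le> (INF h\<in>H. d x (cayley_vertex h))"
  proof (rule cINF_greatest[OF H_nonempty])
    fix h assume h: "h \<in> H"
    then have "\<bar>linear_extension F x - linear_extension F (cayley_vertex h)\<bar> \<le> M * d x (cayley_vertex h)"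
      using H_carrier x F_lipschitz M_pos by (intro linear_extension_lipschitz) auto
    then have "linear_extension F x - 1 \<le> M * d x (cayley_vertex h)" using F_H[OF h] by simp
    then show "(linear_extension F x - 1) / M \<le> d x (cayley_vertex h)"
      using M_pos by (simp add: field_simps)
  qed
  then have "(linear_extension F x - 1) / M \<le> k" using inf by linarith
  then show ?thesis using M_pos by (simp add: field_simps)
qed

lemma deep_cell_far:
  assumes "e \<in> cayley_cells G A" "\<And>v. v \<in> e \<Longrightarrow> 1 + M * k < F v"
  shows "closed_cell e \<subseteq> far k"
proof
  fix x assume x: "x \<in> closed_cell e"
  obtain u v where e: "e = {u, v}" using cayley_cell_card[OF assms(1)] by blast
  have "1 + M * k < linear_extension F x" using linear_extension_gt[OF e x] assms e by auto
  then show "x \<in> far k" using nbhd_bound[of x k] x cell_in_X[OF assms(1)] by (auto simp: far_def)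
qed

lemma vertex_far: "g \<in> carrier G \<Longrightarrow> 1 + M * k < F g \<Longrightarrow> cayley_vertex g \<in> far k"
  using deep_cell_far[OF vertex_cell, of g k] cayley_vertex_in_cell[of "{g}" g] by auto

lemma joined_in_cell:
  assumes "e \<in> cayley_cells G A" "closed_cell e \<subseteq> far k" "p \<in> closed_cell e" "q \<in> closed_cell e"
  shows "joined k p q"
proof -
  obtain C where "connectedin T C" "p \<in> C" "q \<in> C" "C \<subseteq> closed_cell e" using cell_connected assms by blast
  then show ?thesis unfolding joined_def connected_component_of_def
    using assms by (intro exI[of _ C]) (auto simp: connectedin_subtopology)
qed

text \<open>
  A step by \<open>h\<close> is realised by a path of bounded length in the Cayley graph, along
  which \<open>F\<close> drops by at most a constant \<open>C\<close>; a start high enough keeps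
  the path away from \<open>H\<close>.
\<close>

lemma joined_translate:
  assumes "h \<in> carrier G"
  shows "\<exists>C\<ge>0. \<forall>g\<in>carrier G. F g - C \<le> F (g \<otimes> h) \<and>
    (\<forall>k::nat. 1 + M * k + C < F g \<longrightarrow> joined k (cayley_vertex g) (cayley_vertex (g \<otimes> h)))"
proof -
  have edge: "joined k (cayley_vertex g) (cayley_vertex (g \<otimes> a))"
    if "g \<in> carrier G" "a \<in> A" "1 + M * k < F g" "1 + M * k < F (g \<otimes> a)" for g a and k :: nat
    using that by (intro joined_in_cell[OF edge_cell deep_cell_far[OF edge_cell]])
      (auto intro: cayley_vertex_in_cell)
  have "h \<in> generate G A" using assms A_generate by simp
  then show ?thesis
  proof induction
    case one
    then show ?case by (intro exI[of _ 0]) (auto intro: joined_refl vertex_far)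
  next
    case (incl a)
    have "F g - M \<le> F (g \<otimes> a)" if "g \<in> carrier G" for g
      using F_lipschitz[OF that incl] by linarith
    then show ?case using edge incl M_pos by (intro exI[of _ M]) force
  next
    case (inv a)
    have "F g - M \<le> F (g \<otimes> inv a)" if "g \<in> carrier G" for g
      using F_lipschitz[of "g \<otimes> inv a" a] inv that by (simp add: m_assoc)
    moreover have "joined k (cayley_vertex g) (cayley_vertex (g \<otimes> inv a))"
      if "g \<in> carrier G" "1 + M * k < F g" "1 + M * k < F (g \<otimes> inv a)" for g and k :: nat
      using edge[of "g \<otimes> inv a" a k] inv that by (simp add: m_assoc joined_sym)
    ultimately show ?case using M_pos by (intro exI[of _ M]) force
  next
    case (eng h1 h2)
    have h: "h1 \<in> carrier G" "h2 \<in> carrier G" using eng generate_in_carrier A_carrier by blast+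
    obtain C1 where C1: "C1 \<ge> 0" "\<And>g. g \<in> carrier G \<Longrightarrow> F g - C1 \<le> F (g \<otimes> h1)"
      "\<And>g k. g \<in> carrier G \<Longrightarrow> 1 + M * real k + C1 < F g \<Longrightarrow> joined k (cayley_vertex g) (cayley_vertex (g \<otimes> h1))"
      using eng by blast
    obtain C2 where C2: "C2 \<ge> 0" "\<And>g. g \<in> carrier G \<Longrightarrow> F g - C2 \<le> F (g \<otimes> h2)"
      "\<And>g k. g \<in> carrier G \<Longrightarrow> 1 + M * real k + C2 < F g \<Longrightarrow> joined k (cayley_vertex g) (cayley_vertex (g \<otimes> h2))"
      using eng by blast
    have "F g - (C1 + C2) \<le> F (g \<otimes> (h1 \<otimes> h2)) \<and>
        (\<forall>k::nat. 1 + M * k + (C1 + C2) < F g \<longrightarrow> joined k (cayley_vertex g) (cayley_vertex (g \<otimes> (h1 \<otimes> h2))))"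
      if g: "g \<in> carrier G" for g
    proof -
      have gh: "g \<otimes> (h1 \<otimes> h2) = g \<otimes> h1 \<otimes> h2" "g \<otimes> h1 \<in> carrier G" using g h by (auto simp: m_assoc)
      have "F g - C1 \<le> F (g \<otimes> h1)" "F (g \<otimes> h1) - C2 \<le> F (g \<otimes> h1 \<otimes> h2)"
        using C1(2)[OF g] C2(2)[OF gh(2)] by auto
      moreover have "joined k (cayley_vertex g) (cayley_vertex (g \<otimes> h1 \<otimes> h2))"
        if "1 + M * k + (C1 + C2) < F g" for k :: nat
      proof -
        have "1 + M * k + C1 < F g" "1 + M * k + C2 < F (g \<otimes> h1)"
          using that C1(1) C2(1) C1(2)[OF g] by linarith+
        then show ?thesis using joined_trans[OF C1(3)[OF g] C2(3)[OF gh(2)]] by blast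
      qed
      ultimately show ?thesis using gh by auto
    qed
    then show ?case using C1(1) C2(1) by (intro exI[of _ "C1 + C2"]) auto
  qed
qed

text \<open>
  Far from \<open>H\<close> every point lies in a cell with high vertices, because low vertices
  are near \<open>H\<close>.
\<close>

lemma far_cell_deep:
  "\<exists>k0. \<forall>k\<ge>k0. \<forall>x\<in>far k. \<forall>e\<in>cayley_cells G A. x \<in> closed_cell e \<longrightarrow> (\<forall>v\<in>e. real n < F v)"
proof -
  obtain K where K: "\<And>g. g \<in> carrier G \<Longrightarrow> F g \<le> real n \<Longrightarrow> \<exists>h\<in>H. d (cayley_vertex g) (cayley_vertex h) \<le> K"
    using near_H[of n] by blast
  have "real n < F v"
    if k: "nat \<lceil>K + 1\<rceil> \<le> k" and x: "x \<in> far k" and e: "e \<in> cayley_cells G A" "x \<in> closed_cell e" "v \<in> e" for k x e v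
  proof (rule ccontr)
    assume "\<not> real n < F v"
    then have Fv: "F v \<le> real n" by simp
    have v: "v \<in> carrier G" using e cell_carrier by blast
    obtain h where h: "h \<in> H" "d (cayley_vertex v) (cayley_vertex h) \<le> K" using K[OF v Fv] by blast
    have vc: "cayley_vertex v \<in> closed_cell e" by (rule cayley_vertex_in_cell[OF cell_finite[OF e(1)] e(3)])
    have xX: "x \<in> X" using x by (simp add: far_def)
    have "d x (cayley_vertex h) \<le> d x (cayley_vertex v) + d (cayley_vertex v) (cayley_vertex h)"
      using xX v h H_carrier by (intro triangle) auto
    also have "\<dots> \<le> 1 + K"
      using dist_cell[OF e(1,2) vc] segment_length_le_1[OF e(1,2) vc] h(2) by linarith
    also have "\<dots> \<le> k" using k by linarith
    finally have "d x (cayley_vertex h) \<le> k" .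
    moreover have "bdd_below ((\<lambda>h. d x (cayley_vertex h)) ` H)" by (rule bdd_belowI[of _ 0]) auto
    then have "(INF h\<in>H. d x (cayley_vertex h)) \<le> d x (cayley_vertex h)" using h by (intro cINF_lower)
    ultimately have "x \<in> cayley_nbhd G A k H" using xX H_nonempty by (simp add: cayley_nbhd_def)
    then show False using x by (simp add: far_def)
  qed
  then show ?thesis by blast
qed

lemma deep_vertices_joined:
  "\<exists>n. 1 + M * k < real n \<and> (\<forall>g\<in>carrier G. \<forall>h\<in>carrier G. real n \<le> F g \<longrightarrow> real n \<le> F h \<longrightarrow> side g = side h \<longrightarrow>
     joined k (cayley_vertex g) (cayley_vertex h))"
proof -
  obtain C where C: "\<And>b. b \<in> B \<Longrightarrow> C b \<ge> 0"
    "\<And>b g. b \<in> B \<Longrightarrow> g \<in> carrier G \<Longrightarrow> 1 + M * real k + C b < F g \<Longrightarrow> joined k (cayley_vertex g) (cayley_vertex (g \<otimes> b))"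
  proof -
    let ?Q = "\<lambda>b c. 0 \<le> c \<and> (\<forall>g\<in>carrier G. 1 + M * real k + c < F g \<longrightarrow>
        joined k (cayley_vertex g) (cayley_vertex (g \<otimes> b)))"
    have "\<forall>b\<in>B. \<exists>c. ?Q b c"
    proof
      fix b assume "b \<in> B"
      then have "b \<in> carrier G" using B_carrier by blast
      from joined_translate[OF this] show "\<exists>c. ?Q b c" by metis
    qed
    then obtain C where C: "\<forall>b\<in>B. ?Q b (C b)" by (rule bchoice[THEN exE])
    show thesis by (rule that[of C]) (use C in simp_all)
  qed
  define c where "c = 1 + M * k + sum C B"
  have cb: "1 + M * k + C b \<le> c" if "b \<in> B" for b
    using that C(1) B_finite by (auto simp: c_def intro: member_le_sum)
  have c0: "1 + M * k \<le> c" using C(1) by (auto simp: c_def intro: sum_nonneg)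
  define n where "n = nat \<lceil>c\<rceil> + 1"
  have n: "c < real n" unfolding n_def by linarith
  have "joined k (cayley_vertex g) (cayley_vertex h)"
    if g: "g \<in> carrier G" "real n \<le> F g" and h: "h \<in> carrier G" "real n \<le> F h" "side g = side h" for g h
    using deep_connected[OF g(1) h(1) g(2) h(2,3)]
  proof (induction rule: rtranclp_induct)
    case base
    then show ?case using g c0 n by (intro joined_refl vertex_far) auto
  next
    case (step x y)
    then obtain b where b: "b \<in> B" "y = x \<otimes> b" "x \<in> carrier G" "real n \<le> F x" by auto
    then have "joined k (cayley_vertex x) (cayley_vertex y)" using C(2)[OF b(1,3)] cb[OF b(1)] n by auto
    then show ?case using step joined_trans by blast
  qed
  then show ?thesis using c0 n by (intro exI[of _ n]) auto
qed

text \<open>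
  Far from \<open>H\<close> the vertices of an edge are on the same side, so the linear
  extension of the function that is \<open>1\<close> on one side and \<open>-1\<close> on the
  other is continuous with values \<open>1\<close> and \<open>-1\<close> only; it is constant on
  connected sets.
\<close>

lemma joined_same_side:
  "\<exists>k0. \<forall>k\<ge>k0. \<forall>g\<in>carrier G. \<forall>h\<in>carrier G. joined k (cayley_vertex g) (cayley_vertex h) \<longrightarrow> side g = side h"
proof -
  obtain n where n: "\<And>g a. g \<in> carrier G \<Longrightarrow> a \<in> A \<Longrightarrow> real n < F g \<Longrightarrow> side (g \<otimes> a) = side g"
    using side_const by blast
  obtain k0 where k0: "\<And>k x e v. k0 \<le> k \<Longrightarrow> x \<in> far k \<Longrightarrow> e \<in> cayley_cells G A \<Longrightarrow> x \<in> closed_cell e \<Longrightarrow> v \<in> e \<Longrightarrow> real n < F v"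
    using far_cell_deep[of n] by blast
  define \<sigma> where "\<sigma> g = (if side g then 1 else -1 :: real)" for g
  have cont: "continuous_map T euclideanreal (linear_extension \<sigma>)"
    by (rule linear_extension_continuous[of 2]) (auto simp: \<sigma>_def)
  have "side g = side h"
    if k: "k0 \<le> k" and gh: "g \<in> carrier G" "h \<in> carrier G" "joined k (cayley_vertex g) (cayley_vertex h)" for k g h
  proof -
    obtain C where C: "connectedin T C" "C \<subseteq> far k" "cayley_vertex g \<in> C" "cayley_vertex h \<in> C"
      using gh(3) by (auto simp: joined_def connected_component_of_def connectedin_subtopology)
    have "linear_extension \<sigma> x \<in> {1, -1}" if x: "x \<in> C" for x
    proof -
      have xf: "x \<in> far k" using x C by blast
      then obtain e where e: "e \<in> cayley_cells G A" "x \<in> closed_cell e" using X_cell by (auto simp: far_def)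
      obtain u v where uv: "e = {u, v}" "side u = side v"
        using e(1)
      proof (cases rule: cell_cases)
        case (1 g)
        then show ?thesis using that[of g g] by auto
      next
        case (2 g a)
        then show ?thesis using that[of g "g \<otimes> a"] n[of g a] k0[OF k xf e] by auto
      qed
      then have "linear_extension \<sigma> x = \<sigma> u"
        using linear_extension_const[OF uv(1) e(2), of \<sigma> "\<sigma> u"] by (simp add: \<sigma>_def)
      then show ?thesis by (simp add: \<sigma>_def)
    qed
    then have sub: "linear_extension \<sigma> ` C \<subseteq> {1, -1}" by blast
    have "connected (linear_extension \<sigma> ` C)"
      using connectedin_continuous_map_image[OF cont C(1)] by simp
    then obtain c where "linear_extension \<sigma> ` C \<subseteq> {c}"
      using sub connected_finite_iff_sing[of "linear_extension \<sigma> ` C"] finite_subset[OF sub] by auto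
    then have "linear_extension \<sigma> (cayley_vertex g) = linear_extension \<sigma> (cayley_vertex h)"
      using C(3,4) by blast
    then show ?thesis by (simp add: \<sigma>_def split: if_splits)
  qed
  then show ?thesis by blast
qed

text \<open>
  For each side the components containing its high vertices form a pole \<open>P
  \<sigma>\<close>. Conversely, the component \<open>U k\<close> of a pole contains \<open>U
  l\<close> for all \<open>l \<ge> k\<close> and therefore high vertices, so it is the component
  \<open>P \<sigma> k\<close> for some side \<open>\<sigma>\<close>; the side does not depend on
  \<open>k\<close> because far from \<open>H\<close> components do not meet both sides.
\<close>

theorem two_poles: "finite (poles G A H) \<and> card (poles G A H) = 2"
proof -
  let ?Y = "\<lambda>k. subtopology T (far k)"
  have poles_eq: "poles G A H = {U. \<forall>k. U k \<in> connected_components_of (?Y (Suc k)) \<and> U (Suc k) \<subseteq> U k}"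
    by (simp add: poles_def far_def)
  obtain n where n: "\<And>k. 1 + M * real k < real (n k)"
    and n_joined: "\<And>k g h. g \<in> carrier G \<Longrightarrow> h \<in> carrier G \<Longrightarrow> real (n k) \<le> F g \<Longrightarrow> real (n k) \<le> F h \<Longrightarrow>
      side g = side h \<Longrightarrow> joined k (cayley_vertex g) (cayley_vertex h)"
  proof -
    have "\<exists>n. \<forall>k. 1 + M * real k < real (n k) \<and> (\<forall>g\<in>carrier G. \<forall>h\<in>carrier G. real (n k) \<le> F g \<longrightarrow>
        real (n k) \<le> F h \<longrightarrow> side g = side h \<longrightarrow> joined k (cayley_vertex g) (cayley_vertex h))"
      by (rule choice) (use deep_vertices_joined in blast)
    then show thesis using that by blast
  qed
  obtain g where g: "\<And>\<sigma> k. g \<sigma> k \<in> carrier G" "\<And>\<sigma> k. side (g \<sigma> k) = \<sigma>"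
    and g_sum: "\<And>\<sigma> k. real (\<Sum>j\<le>k. n j) \<le> F (g \<sigma> k)"
  proof -
    have "\<forall>\<sigma> k. \<exists>h. h \<in> carrier G \<and> side h = \<sigma> \<and> real (\<Sum>j\<le>k. n j) \<le> F h"
      using F_unbounded by blast
    then obtain g where "\<forall>\<sigma> k. g \<sigma> k \<in> carrier G \<and> side (g \<sigma> k) = \<sigma> \<and> real (\<Sum>j\<le>k. n j) \<le> F (g \<sigma> k)"
      by metis
    then show thesis using that by blast
  qed
  \<comment> \<open>The sum in the choice of \<open>g\<close> makes one vertex high enough for all earlier
    levels at once, so that the components at successive levels are nested.\<close>
  have g_deep: "real (n j) \<le> F (g \<sigma> k)" if "j \<le> k" for \<sigma> j k
  proof -
    have "n j \<le> (\<Sum>j\<le>k. n j)" using that by (intro member_le_sum) auto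
    then show ?thesis using g_sum[of k \<sigma>] by linarith
  qed
  have g_joined: "joined j (cayley_vertex (g \<sigma> k)) (cayley_vertex (g \<sigma> l))" if "j \<le> k" "j \<le> l" for \<sigma> j k l
    using that g g_deep by (intro n_joined) auto
  have g_far: "cayley_vertex (g \<sigma> k) \<in> far j" if "j \<le> k" for \<sigma> j k
    using vertex_far[OF g(1), of j \<sigma> k] g_deep[OF that, of \<sigma>] n[of j] by simp
  define P where "P \<sigma> k = connected_component_of_set (?Y (Suc k)) (cayley_vertex (g \<sigma> (Suc k)))" for \<sigma> k
  have P_joined: "P \<sigma> k = {x. joined (Suc k) (cayley_vertex (g \<sigma> (Suc k))) x}" for \<sigma> k
    by (simp add: P_def joined_def)
  have P_pole: "P \<sigma> \<in> poles G A H" for \<sigma>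
    unfolding poles_eq
  proof (intro CollectI allI conjI)
    fix k
    show "P \<sigma> k \<in> connected_components_of (?Y (Suc k))"
      unfolding P_def connected_component_in_connected_components_of topspace_far by (rule g_far) simp
    show "P \<sigma> (Suc k) \<subseteq> P \<sigma> k"
    proof
      fix x assume "x \<in> P \<sigma> (Suc k)"
      then have "joined (Suc k) (cayley_vertex (g \<sigma> (Suc (Suc k)))) x"
        unfolding P_joined by (auto intro: joined_mono)
      moreover have "joined (Suc k) (cayley_vertex (g \<sigma> (Suc k))) (cayley_vertex (g \<sigma> (Suc (Suc k))))"
        by (rule g_joined) auto
      ultimately show "x \<in> P \<sigma> k" unfolding P_joined using joined_trans by blast
    qed
  qed
  obtain k0 where k0: "\<And>k g h. k0 \<le> k \<Longrightarrow> g \<in> carrier G \<Longrightarrow> h \<in> carrier G \<Longrightarrow>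
      joined k (cayley_vertex g) (cayley_vertex h) \<Longrightarrow> side g = side h"
    using joined_same_side by blast
  have g_in_P: "cayley_vertex (g \<sigma> l) \<in> P \<tau> k \<longleftrightarrow> \<sigma> = \<tau>" if "k0 \<le> k" "k < l" for \<sigma> \<tau> k l
  proof
    assume "cayley_vertex (g \<sigma> l) \<in> P \<tau> k"
    then show "\<sigma> = \<tau>"
      using k0[of "Suc k" "g \<tau> (Suc k)" "g \<sigma> l"] that(1) g by (simp add: P_joined)
  next
    assume "\<sigma> = \<tau>"
    then show "cayley_vertex (g \<sigma> l) \<in> P \<tau> k" using g_joined[of "Suc k" "Suc k" l \<tau>] that(2) by (simp add: P_joined)
  qed
  have "U = P True \<or> U = P False" if U: "U \<in> poles G A H" for U
  proof -
    have comp: "U k \<in> connected_components_of (?Y (Suc k))" for k using U unfolding poles_eq by simp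
    have "U (Suc k) \<subseteq> U k" for k using U unfolding poles_eq by simp
    then have mono: "U l \<subseteq> U k" if "k \<le> l" for k l
      using that by (rule lift_Suc_antimono_le)
    have eqI: "U k = P \<sigma> k" if "x \<in> U k" "joined (Suc k) (cayley_vertex (g \<sigma> (Suc k))) x" for \<sigma> k x
    proof -
      have "connected_component_of (?Y (Suc k)) (cayley_vertex (g \<sigma> (Suc k))) = connected_component_of (?Y (Suc k)) x"
        using that(2) connected_component_of_equiv unfolding joined_def by metis
      then show ?thesis using component_eqI[OF comp that(1)] by (simp add: P_def)
    qed
    have "\<exists>\<sigma>. U k = P \<sigma> k" for k
    proof -
      obtain k1 where k1: "\<And>k' x e v. k1 \<le> k' \<Longrightarrow> x \<in> far k' \<Longrightarrow> e \<in> cayley_cells G A \<Longrightarrow> x \<in> closed_cell e \<Longrightarrow> v \<in> e \<Longrightarrow> real (n (Suc k)) < F v"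
        using far_cell_deep[of "n (Suc k)"] by blast
      let ?K = "max k1 k"
      obtain x where x: "x \<in> U ?K" using nonempty_connected_components_of[OF comp] by blast
      then have xf: "x \<in> far (Suc ?K)" using connected_components_of_subset[OF comp] topspace_far by blast
      then obtain e where e: "e \<in> cayley_cells G A" "x \<in> closed_cell e" using X_cell by (auto simp: far_def)
      obtain v where v: "v \<in> e" "v \<in> carrier G" using e(1) cell_cases by blast
      have deep: "real (n (Suc k)) < F w" if "w \<in> e" for w
        using k1[of "Suc ?K", OF _ xf e that] by simp
      have "joined (Suc k) x (cayley_vertex v)"
      proof (rule joined_in_cell[OF e(1) deep_cell_far[OF e(1)] e(2)])
        show "cayley_vertex v \<in> closed_cell e" by (rule cayley_vertex_in_cell[OF cell_finite[OF e(1)] v(1)])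
        show "1 + M * real (Suc k) < F w" if "w \<in> e" for w using deep[OF that] n[of "Suc k"] by linarith
      qed
      moreover have "joined (Suc k) (cayley_vertex v) (cayley_vertex (g (side v) (Suc k)))"
        using deep[OF v(1)] v g g_deep by (intro n_joined) auto
      ultimately have "joined (Suc k) (cayley_vertex (g (side v) (Suc k))) x"
        using joined_trans joined_sym by blast
      moreover have "x \<in> U k" using x mono[of k ?K] by auto
      ultimately show ?thesis using eqI by blast
    qed
    then obtain \<sigma> where \<sigma>: "\<And>k. U k = P (\<sigma> k) k" by metis
    have "U k = P (\<sigma> k0) k" for k
    proof -
      let ?K = "max k k0"
      let ?x = "cayley_vertex (g (\<sigma> ?K) (Suc ?K))"
      have x: "?x \<in> U ?K" using \<sigma>[of ?K] g_in_P[of ?K "Suc ?K"] by simp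
      then have "?x \<in> P (\<sigma> k0) k0" using mono[of k0 ?K] \<sigma>[of k0] by auto
      then have "\<sigma> ?K = \<sigma> k0" using g_in_P[of k0 "Suc ?K"] by simp
      moreover have "?x \<in> U k" using x mono[of k ?K] by auto
      ultimately show ?thesis using eqI[of ?x k "\<sigma> k0"] g_joined[of "Suc k" "Suc k" "Suc ?K" "\<sigma> k0"] by simp
    qed
    then have "U = P (\<sigma> k0)" by blast
    then show ?thesis by (cases "\<sigma> k0") auto
  qed
  then have "poles G A H = {P True, P False}" using P_pole by blast
  moreover have "P True \<noteq> P False"
    using g_in_P[of k0 "Suc k0" True True] g_in_P[of k0 "Suc k0" True False] by auto
  ultimately show ?thesis by simp
qed

end

section \<open>Bipolarity of irreducible 2-spherical Coxeter groups\<close>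

context reflection_cocycle begin

theorem two_poles_centraliser:
  assumes fin: "\<And>a b. a \<in> S \<Longrightarrow> b \<in> S \<Longrightarrow> finite (generate G {a, b})"
    and "finite S" "infinite (carrier G)" "irreducible_gens G S" "s \<in> S" "finite_generating_set G A"
  shows "finite (poles G A (centraliser G s)) \<and> card (poles G A (centraliser G s)) = 2"
proof -
  have A: "finite A" "A \<subseteq> carrier G" "generate G A = carrier G"
    using assms by (auto simp: finite_generating_set_def)
  interpret cayley G A by unfold_locales (use A in auto)
  define C where "C = (\<Sum>a\<in>A. 2 * len a)"
  have C: "2 * len a \<le> C" if "a \<in> A" for a
    unfolding C_def using that A(1) by (intro member_le_sum[of a A "\<lambda>a. 2 * len a"]) auto
  have s: "s \<in> carrier G" using assms by auto
  interpret coarse_half_spaces G A "centraliser G s" "\<lambda>w. real (depth s w)" "\<lambda>w. s \<in> N w" S "real (C + 1)"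
  proof unfold_locales
    show "centraliser G s \<noteq> {}" using s by (auto simp: centraliser_def)
    show "centraliser G s \<subseteq> carrier G" by (auto simp: centraliser_def)
    show "real (depth s h) \<le> 1" if "h \<in> centraliser G s" for h using depth_centraliser assms that by simp
    show "0 < real (C + 1)" by simp
    show "\<bar>real (depth s g) - real (depth s (g \<otimes> a))\<bar> \<le> real (C + 1)" if "g \<in> carrier G" "a \<in> A" for g a
      using depth_mult_le[of s g a] C[OF that(2)] that assms A by auto
    show "\<exists>K. \<forall>g\<in>carrier G. real (depth s g) \<le> real n \<longrightarrow>
        (\<exists>h\<in>centraliser G s. d (cayley_vertex g) (cayley_vertex h) \<le> K)" for n
    proof -
      obtain V where V: "finite V" "V \<subseteq> carrier G"
        "\<And>w. w \<in> carrier G \<Longrightarrow> depth s w \<le> n \<Longrightarrow> \<exists>v\<in>V. w \<otimes> v \<in> centraliser G s"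
        using shallow_near_centraliser[OF assms(2,5), of n] by blast
      have "\<forall>v\<in>V. \<exists>L. \<forall>g\<in>carrier G. d (cayley_vertex g) (cayley_vertex (g \<otimes> v)) \<le> L"
        using dist_mult_bounded V by blast
      then obtain L where "\<forall>v\<in>V. \<forall>g\<in>carrier G. d (cayley_vertex g) (cayley_vertex (g \<otimes> v)) \<le> L v"
        by (rule bchoice[THEN exE])
      then have L: "d (cayley_vertex g) (cayley_vertex (g \<otimes> v)) \<le> L v"
        if "v \<in> V" "g \<in> carrier G" for v g using that by blast
      have L_le: "L v \<le> (\<Sum>v\<in>V. \<bar>L v\<bar>)" if "v \<in> V" for v
        using member_le_sum[of v V "\<lambda>v. \<bar>L v\<bar>"] that V(1) by fastforce
      show ?thesis
      proof (intro exI[of _ "\<Sum>v\<in>V. \<bar>L v\<bar>"] ballI impI)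
        fix g assume g: "g \<in> carrier G" "real (depth s g) \<le> real n"
        then obtain v where v: "v \<in> V" "g \<otimes> v \<in> centraliser G s" using V(3)[of g] by auto
        then show "\<exists>h\<in>centraliser G s. d (cayley_vertex g) (cayley_vertex h) \<le> (\<Sum>v\<in>V. \<bar>L v\<bar>)"
          using order_trans[OF L[OF v(1) g(1)] L_le[OF v(1)]] by blast
      qed
    qed
    show "\<exists>n. \<forall>g\<in>carrier G. \<forall>a\<in>A. real n < real (depth s g) \<longrightarrow> (s \<in> N (g \<otimes> a)) = (s \<in> N g)"
    proof (intro exI[of _ C] ballI impI)
      fix g a assume "g \<in> carrier G" "a \<in> A" "real C < real (depth s g)"
      then show "(s \<in> N (g \<otimes> a)) = (s \<in> N g)" using C[of a] assms A by (intro crossing_bound) auto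
    qed
    show "finite S" "S \<subseteq> carrier G" using assms by auto
    show "(\<lambda>x y. x \<in> carrier G \<and> real n \<le> real (depth s x) \<and> (\<exists>b\<in>S. y = x \<otimes> b))\<^sup>*\<^sup>* g h"
      if "g \<in> carrier G" "h \<in> carrier G" "real n \<le> real (depth s g)" "real n \<le> real (depth s h)"
        "(s \<in> N g) = (s \<in> N h)" for g h n
      using deep_side_connected[OF fin assms(5), of g h n] that by simp
    show "\<exists>g\<in>carrier G. (s \<in> N g) = \<sigma> \<and> real n \<le> real (depth s g)" for \<sigma> n
      using depth_unbounded[OF assms(2-5)] by simp
  qed
  show ?thesis by (rule two_poles)
qed

end

theorem corollary1p3:
  fixes W :: "('a, 'b) monoid_scheme"
  assumes "group W"
    and "finitely_generated W"
    and "infinite (carrier W)"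
    and "\<exists>S. coxeter_generating_set W S \<and> irreducible_gens W S \<and> two_spherical W S"
  shows "bipolar W"
proof -
  obtain S where S: "coxeter_generating_set W S" "irreducible_gens W S" "two_spherical W S"
    using assms(4) by blast
  obtain N where "reflection_cocycle W S N"
    using group.coxeter_reflection_cocycle[OF assms(1) S(1)] by blast
  then interpret reflection_cocycle W S N .
  have finS: "finite S" using finite_generators assms(2) by blast
  have fin: "finite (generate W {a, b})" if ab: "a \<in> S" "b \<in> S" for a b
  proof (cases "a = b")
    case False
    then show ?thesis using S(3) ab by (simp add: two_spherical_def)
  next
    case True
    have "x \<in> {\<one>\<^bsub>W\<^esub>, a}" if "x \<in> generate W {a}" for x
      using that by induction (use ab in \<open>auto simp: S_square\<close>)
    then show ?thesis using True finite_subset[of "generate W {a}" "{\<one>\<^bsub>W\<^esub>, a}"] by auto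
  qed
  have "bipolar_element W s" if "s \<in> S" for s
    unfolding bipolar_element_def has_num_poles_def
    using two_poles_centraliser[OF fin finS assms(3) S(2) that] assms(2) by blast
  then show ?thesis using S(1) by (auto simp: bipolar_def)
qed

end
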